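(* Let $G_n^{0,q}$ be a $(0,q)$-perturbed noisy random geometric graph in the standard setting described in the context (so $q=q(n)\in[0,1]$ may depend on $n$). Then: (I) Suppose that $nr^d \le n^{-\alpha}$ for some fixed $\alpha \in (0, 1/\beta^2]$, where $\beta$ is the Besicovitch constant. Then there exist constants $C_1, C_2$ such that (I.a) if $q \le (1/n)^{C_1}$, then a.s. $\omega(G_n^{0,q}) \sim 1$; (I.b) if $(1/n)^{C_1} < q \le C_2$, then a.s. $\omega(G_n^{0,q}) \sim \log_{1/q} n$. (II) Suppose that for every $\epsilon>0$, $n^{-\epsilon} \ll nr^d \ll \log n$. Then there exist constants $C_1, C_2$ such that (II.a) if $q \le (nr^d/\log n)^{C_1}$, then a.s. $\omega(G_n^{0,q}) \sim \dfrac{\log n}{\log(\log n/(nr^d))}$; (II.b) if $(nr^d/\log n)^{C_1} < q \le C_2$, then a.s. $\omega(G_n^{0,q}) \sim \log_{1/q} n$. (III) Suppose that $\sigma n r^d/\log n \to t \in (0,\infty)$ as $n\to\infty$. Then there exists a constant $C_1$ such that if $q \le C_1$, then a.s. $\omega(G_n^{0,q}) \sim nr^d$.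
   Context: Standard setting: fix an integer $d\ge 1$ and an arbitrary norm $\|\cdot\|$ on $\mathbb{R}^d$; $B_s(x)=\{y:\|y-x\|\le s\}$, and $\theta$ is the Lebesgue volume of $B_1(0)$. Let $\nu$ be a probability distribution on $\mathbb{R}^d$ with a bounded density $f$, and let $\sigma$ (the maximum density) be the essential supremum of $f$. Let $X_1,X_2,\dots$ be i.i.d. with law $\nu$, and let $r=r(n)>0$ with $r(n)\to 0$. $G_n$ is the random geometric graph with vertex set $\{X_1,\dots,X_n\}$ in which distinct $X_i,X_j$ are adjacent iff $\|X_i-X_j\|\le r(n)$. For $p,q\in[0,1]$, the $(p,q)$-perturbed noisy random geometric graph $G_n^{p,q}$ is obtained from $G_n$ by deleting each edge of $G_n$ independently with probability $p$ and inserting each non-edge of $G_n$ independently with probability $q$. $\omega(G)$ is the clique number (largest size of a complete subgraph). Besicovitch constant: a $\delta$-packing with respect to $P\subseteq\mathbb{R}^d$ is a countable collection of pairwise disjoint closed balls of radius $\delta$ centered at points of $P$. The Besicovitch constant $\beta=\beta(d)\in\mathbb{N}$ is a constant such that for every $P\subseteq\mathbb{R}^d$ and every $\delta>0$ there are $\beta$ $\delta$-packings with respect to $P$ whose union covers $P$. Asymptotic notation: $f\ll g$ means $f(n)/g(n)\to 0$. For random variables $\xi_n$ and positive numbers $k_n$: "a.s. $\xi_n\lesssim k_n$" means there is a constant $C>0$ with $\lim_n \Pr[\xi_n\le Ck_n]=1$; "a.s. $\xi_n\gtrsim k_n$" means there is a constant $c>0$ with $\lim_n\Pr[\xi_n\ge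 ck_n]=1$; "a.s. $\xi_n\sim k_n$" means both hold. *)

theory Defs
  imports "HOL-Probability.Probability" "HOL-Library.Ramsey"
begin

definition is_norm :: "('a::real_vector \<Rightarrow> real) \<Rightarrow> bool" where
  "is_norm N \<longleftrightarrow>
     (\<forall>x. N x = 0 \<longleftrightarrow> x = 0) \<and>
     (\<forall>c x. N (c *\<^sub>R x) = \<bar>c\<bar> * N x) \<and>
     (\<forall>x y. N (x + y) \<le> N x + N y)"

definition norm_ball :: "('a::real_vector \<Rightarrow> real) \<Rightarrow> 'a \<Rightarrow> real \<Rightarrow> 'a set" where
  "norm_ball N x s = {y. N (y - x) \<le> s}"

definition is_packing :: "('a::real_vector \<Rightarrow> real) \<Rightarrow> real \<Rightarrow> 'a set \<Rightarrow> 'a set set \<Rightarrow> bool" where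
  "is_packing N \<delta> P \<B> \<longleftrightarrow>
     countable \<B> \<and> disjoint \<B> \<and> (\<forall>B\<in>\<B>. \<exists>x\<in>P. B = norm_ball N x \<delta>)"

text \<open>The Besicovitch constant is only required to have the covering property, not to be the
  least number that has it.\<close>

definition besicovitch_constant :: "('a::real_vector \<Rightarrow> real) \<Rightarrow> nat \<Rightarrow> bool" where
  "besicovitch_constant N \<beta> \<longleftrightarrow>
     (\<forall>P. \<forall>\<delta>>0. \<exists>\<B> :: nat \<Rightarrow> 'a set set.
        (\<forall>i<\<beta>. is_packing N \<delta> P (\<B> i)) \<and> P \<subseteq> (\<Union>i<\<beta>. \<Union>(\<B> i)))"

definition has_bounded_density :: "'a::euclidean_space measure \<Rightarrow> ('a \<Rightarrow> real) \<Rightarrow> bool" where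
  "has_bounded_density \<nu> f \<longleftrightarrow>
     prob_space \<nu> \<and> f \<in> borel_measurable borel \<and> (\<forall>x. 0 \<le> f x) \<and> bounded (range f) \<and>
     \<nu> = density lborel (\<lambda>x. ennreal (f x))"

definition max_density :: "('a::euclidean_space \<Rightarrow> real) \<Rightarrow> real" where
  "max_density f = real_of_ereal (esssup lborel (\<lambda>x. ereal (f x)))"

text \<open>A graph is given by a vertex set and a set of two-element edges. The vertex \<open>i\<close> stands for
  the point \<open>X i\<close>; since the points have a density, they are almost surely distinct.\<close>

definition clique_number :: "'v set \<Rightarrow> 'v set set \<Rightarrow> nat" where
  "clique_number V E = Max {card S | S. S \<subseteq> V \<and> clique S E}"

definition rgg_edges :: "('a::real_vector \<Rightarrow> real) \<Rightarrow> real \<Rightarrow> nat \<Rightarrow> (nat \<Rightarrow> 'a) \<Rightarrow> nat set set" where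
  "rgg_edges N s n x = {{i, j} | i j. i < n \<and> j < n \<and> i \<noteq> j \<and> N (x i - x j) \<le> s}"

definition perturb :: "'v set \<Rightarrow> ('v set \<Rightarrow> bool) \<Rightarrow> ('v set \<Rightarrow> bool) \<Rightarrow> 'v set set \<Rightarrow> 'v set set" where
  "perturb V del ins E = {e \<in> [V]\<^bsup>2\<^esup>. if e \<in> E then \<not> del e else ins e}"

text \<open>The sources of randomness of the noisy graph on \<open>n\<close> vertices: the points, and for every pair
  \<open>e\<close> of vertices two coins, one deleting \<open>e\<close> (if it is an edge), one inserting \<open>e\<close> (if it is a
  non-edge). The heterogeneous types rule out \<open>indep_vars\<close> for their joint independence, so it
  is stated via \<open>indep_sets\<close> for the generated families of events.\<close>

datatype source = Point nat | Deletion "nat set" | Insertion "nat set"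

fun source_events ::
  "'w measure \<Rightarrow> (nat \<Rightarrow> 'w \<Rightarrow> 'a::euclidean_space) \<Rightarrow> (nat set \<Rightarrow> 'w \<Rightarrow> bool) \<Rightarrow>
   (nat set \<Rightarrow> 'w \<Rightarrow> bool) \<Rightarrow> source \<Rightarrow> 'w set set" where
  "source_events M X del ins (Point i) = {X i -` A \<inter> space M | A. A \<in> sets borel}"
| "source_events M X del ins (Deletion e) = {del e -` A \<inter> space M | A. A \<in> sets (count_space UNIV)}"
| "source_events M X del ins (Insertion e) = {ins e -` A \<inter> space M | A. A \<in> sets (count_space UNIV)}"

text \<open>No assumption relates the coins of different \<open>n\<close>; only the law of each single noisy graph
  is prescribed.\<close>

definition noisy_rgg_model ::
  "'w measure \<Rightarrow> 'a::euclidean_space measure \<Rightarrow> (nat \<Rightarrow> 'w \<Rightarrow> 'a) \<Rightarrow> (nat \<Rightarrow> real) \<Rightarrow> (nat \<Rightarrow> real) \<Rightarrow>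
   (nat \<Rightarrow> nat set \<Rightarrow> 'w \<Rightarrow> bool) \<Rightarrow> (nat \<Rightarrow> nat set \<Rightarrow> 'w \<Rightarrow> bool) \<Rightarrow> bool" where
  "noisy_rgg_model M \<nu> X p q del ins \<longleftrightarrow>
     prob_space M \<and>
     prob_space.indep_vars M (\<lambda>_. borel) X UNIV \<and>
     (\<forall>i. distr M borel (X i) = \<nu>) \<and>
     (\<forall>n. \<forall>e\<in>[{..<n}]\<^bsup>2\<^esup>.
        del n e \<in> measurable M (count_space UNIV) \<and> measure M {\<omega> \<in> space M. del n e \<omega>} = p n \<and>
        ins n e \<in> measurable M (count_space UNIV) \<and> measure M {\<omega> \<in> space M. ins n e \<omega>} = q n) \<and>
     (\<forall>n. prob_space.indep_sets M (source_events M X (del n) (ins n))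
        (range Point \<union> Deletion ` [{..<n}]\<^bsup>2\<^esup> \<union> Insertion ` [{..<n}]\<^bsup>2\<^esup>))"

definition noisy_clique_number ::
  "('a::euclidean_space \<Rightarrow> real) \<Rightarrow> (nat \<Rightarrow> real) \<Rightarrow> (nat \<Rightarrow> 'w \<Rightarrow> 'a) \<Rightarrow>
   (nat \<Rightarrow> nat set \<Rightarrow> 'w \<Rightarrow> bool) \<Rightarrow> (nat \<Rightarrow> nat set \<Rightarrow> 'w \<Rightarrow> bool) \<Rightarrow> nat \<Rightarrow> 'w \<Rightarrow> real" where
  "noisy_clique_number N r X del ins n \<omega> =
     real (clique_number {..<n}
       (perturb {..<n} (\<lambda>e. del n e \<omega>) (\<lambda>e. ins n e \<omega>) (rgg_edges N (r n) n (\<lambda>i. X i \<omega>))))"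

definition much_less :: "(nat \<Rightarrow> real) \<Rightarrow> (nat \<Rightarrow> real) \<Rightarrow> bool"  (infix \<open>\<lless>\<close> 50) where
  "g \<lless> h \<longleftrightarrow> (\<lambda>n. g n / h n) \<longlonglongrightarrow> 0"

definition as_lesssim :: "'w measure \<Rightarrow> (nat \<Rightarrow> 'w \<Rightarrow> real) \<Rightarrow> (nat \<Rightarrow> real) \<Rightarrow> bool" where
  "as_lesssim M \<xi> k \<longleftrightarrow>
     (\<exists>C>0. (\<lambda>n. measure M {\<omega> \<in> space M. \<xi> n \<omega> \<le> C * k n}) \<longlonglongrightarrow> 1)"

definition as_gtrsim :: "'w measure \<Rightarrow> (nat \<Rightarrow> 'w \<Rightarrow> real) \<Rightarrow> (nat \<Rightarrow> real) \<Rightarrow> bool" where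
  "as_gtrsim M \<xi> k \<longleftrightarrow>
     (\<exists>c>0. (\<lambda>n. measure M {\<omega> \<in> space M. \<xi> n \<omega> \<ge> c * k n}) \<longlonglongrightarrow> 1)"

definition as_sim :: "'w measure \<Rightarrow> (nat \<Rightarrow> 'w \<Rightarrow> real) \<Rightarrow> (nat \<Rightarrow> real) \<Rightarrow> bool" where
  "as_sim M \<xi> k \<longleftrightarrow> as_lesssim M \<xi> k \<and> as_gtrsim M \<xi> k"

end

theory Submission
  imports Defs "HOL-Real_Asymp.Real_Asymp"
begin

text \<open>
  Upper bounds: let \<open>S\<close> be a clique with \<open>2 * j\<close> vertices. Either some vertex of \<open>S\<close> has \<open>j\<close> others of
  \<open>S\<close> within distance \<open>r\<close>, or at least \<open>j\<^sup>2\<close> pairs of \<open>S\<close> were inserted. Union bounds turn this into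
  a failure probability of at most \<open>n * (C * n * r ^ d / j) ^ j + (n\<^sup>2 * (4 * q) ^ j) ^ j\<close>, which vanishes
  as soon as \<open>j\<close> is a large multiple of the claimed order of growth. A single estimate thus covers all
  regimes.

  Lower bounds: if \<open>q\<close> is large, cliques of size about \<open>log_{1/q} n / 2\<close> are grown greedily from
  inserted pairs alone. If \<open>q\<close> is small, a positive proportion of about \<open>r ^ (- d)\<close> grid cells of
  diameter at most \<open>r\<close> have mass of order \<open>r ^ d\<close>, and a second moment argument shows that one of them
  contains many points.
\<close>

section \<open>Norms and bounded densities\<close>

text \<open>The dichotomy separates geometry from coins: each event in the union bound concerns the
  points alone or the insertion coins alone. With \<open>s = n * r ^ d\<close>, the two conditions
  on \<open>j\<close> are that \<open>n^2 * (C * s / j) ^ j\<close> and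
  \<open>n^3 * (4 * q) ^ j\<close> are at most 1. The first asks for a constant \<open>j\<close> if
  \<open>s\<close> is polynomially small, for the order \<open>ln n / ln (ln n / s)\<close> in the
  intermediate range, and for the order \<open>ln n\<close> if \<open>s\<close> has that order. The
  second asks for the order \<open>log_{1/q} n\<close>. The two orders coincide at
  \<open>q = 1 / n\<close> and at \<open>q = s / ln n\<close> respectively, whence
  \<open>C1 = 1\<close>. The factor 4 pays for choosing the inserted pairs: \<open>2 * j\<close>
  vertices have at most \<open>2 * j^2\<close> pairs, hence at most \<open>4 ^ (j^2)\<close> sets of
  pairs. For \<open>q\<close> up to \<open>C2 = 1/16\<close> one has \<open>4 * q\<close> at most
  \<open>sqrt q\<close>, so this choice costs only a constant factor in \<open>j\<close>. Both lower
  bounds balance at \<open>n^(-1/2)\<close>: a vertex is joined to a whole set, or a cell is hit by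
  all groups, with at least this probability, while about \<open>n\<close> vertices, or at least of
  order \<open>n / ln n\<close> cells, are available.\<close>

context
  fixes N :: "'a::euclidean_space \<Rightarrow> real"
  assumes N: "is_norm N"
begin

lemma is_norm_zero: "N 0 = 0" and is_norm_scaleR: "N (c *\<^sub>R x) = \<bar>c\<bar> * N x"
  and is_norm_add: "N (x + y) \<le> N x + N y"
  using N by (auto simp: is_norm_def)

lemma is_norm_uminus: "N (- x) = N x"
  using is_norm_scaleR[of "-1" x] by simp

lemma is_norm_minus_commute: "N (x - y) = N (y - x)"
  using is_norm_uminus[of "x - y"] by simp

lemma is_norm_nonneg: "0 \<le> N x"
  using is_norm_add[of x "- x"] is_norm_uminus[of x] is_norm_zero by simp

lemma is_norm_sum: "finite I \<Longrightarrow> N (\<Sum>i\<in>I. g i) \<le> (\<Sum>i\<in>I. N (g i))"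
proof (induction I rule: finite_induct)
  case (insert i I)
  then show ?case using is_norm_add[of "g i" "\<Sum>i\<in>I. g i"] by simp
qed (simp add: is_norm_zero)

lemma is_norm_le_norm: "\<exists>K\<ge>1. \<forall>x. N x \<le> K * norm x"
proof (intro exI conjI allI)
  fix x :: 'a
  have "N x = N (\<Sum>i\<in>Basis. (x \<bullet> i) *\<^sub>R i)" by (simp add: euclidean_representation)
  also have "\<dots> \<le> (\<Sum>i\<in>Basis. N ((x \<bullet> i) *\<^sub>R i))" by (intro is_norm_sum) auto
  also have "\<dots> = (\<Sum>i\<in>Basis. \<bar>x \<bullet> i\<bar> * N i)" by (simp add: is_norm_scaleR)
  also have "\<dots> \<le> (\<Sum>i\<in>Basis. norm x * N i)"
    by (intro sum_mono mult_right_mono Basis_le_norm is_norm_nonneg)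
  \<comment> \<open>The summand 1 makes the constant at least 1, so that the grid cells later have
    side at most \<open>s\<close>.\<close>
  also have "\<dots> \<le> (1 + (\<Sum>i\<in>Basis. N i)) * norm x"
    by (simp add: sum_distrib_left[symmetric] algebra_simps flip: sum_distrib_right)
  finally show "N x \<le> (1 + (\<Sum>i\<in>Basis. N i)) * norm x" .
qed (simp add: sum_nonneg is_norm_nonneg)

lemma is_norm_continuous: "continuous_on UNIV N"
proof -
  obtain K where K: "K \<ge> 1" "\<And>x. N x \<le> K * norm x" using is_norm_le_norm by blast
  have "K-lipschitz_on UNIV N"
  proof (rule lipschitz_onI)
    fix x y :: 'a
    have "N x \<le> N y + N (x - y)" "N y \<le> N x + N (x - y)"
      using is_norm_add[of y "x - y"] is_norm_add[of x "y - x"] by (auto simp: is_norm_minus_commute)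
    then show "dist (N x) (N y) \<le> K * dist x y"
      using K(2)[of "x - y"] by (auto simp: dist_norm)
  qed (use K in auto)
  then show ?thesis by (rule lipschitz_on_continuous_on)
qed

lemma is_norm_measurable: "N \<in> borel_measurable borel"
  using is_norm_continuous by (rule borel_measurable_continuous_onI)

text \<open>By compactness \<open>N\<close> attains its minimum on the Euclidean unit sphere. It is
  positive because \<open>N\<close> vanishes only at 0, and homogeneity extends the bound to all
  vectors.\<close>

lemma norm_le_is_norm: "\<exists>\<kappa>>0. \<forall>x. \<kappa> * norm x \<le> N x"
proof -
  have "sphere (0::'a) 1 \<noteq> {}" by simp
  then obtain z where z: "z \<in> sphere 0 1" "\<And>y. y \<in> sphere 0 1 \<Longrightarrow> N z \<le> N y"
    using continuous_attains_inf[of "sphere 0 1" N] continuous_on_subset[OF is_norm_continuous]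
    by (metis compact_sphere top_greatest)
  have pos: "N z > 0" using z(1) N is_norm_nonneg[of z] by (auto simp: is_norm_def order_less_le)
  have "N z * norm x \<le> N x" for x
  proof (cases "x = 0")
    case False
    then have "N z \<le> N ((1 / norm x) *\<^sub>R x)" by (intro z(2)) simp
    with False show ?thesis unfolding is_norm_scaleR by (simp add: field_simps)
  qed (simp add: is_norm_zero)
  with pos show ?thesis by blast
qed

end

text \<open>Half-open cubes of side \<open>h\<close>. Taking floors makes cells with different
  indices on \<open>Basis\<close> truly disjoint, not merely disjoint up to null sets.\<close>

definition grid_cell :: "real \<Rightarrow> ('a::euclidean_space \<Rightarrow> int) \<Rightarrow> 'a set" where
  "grid_cell h z = {x. \<forall>i\<in>Basis. \<lfloor>(x \<bullet> i) / h\<rfloor> = z i}"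

section \<open>Masses of balls and of grid cells\<close>

context
  fixes \<nu> :: "'a::euclidean_space measure" and f :: "'a \<Rightarrow> real"
  assumes f: "has_bounded_density \<nu> f"
begin

lemma bounded_density_prob_space: "prob_space \<nu>" and bounded_density_sets: "sets \<nu> = sets borel"
  using f by (auto simp: has_bounded_density_def)

lemma bounded_density_space: "space \<nu> = UNIV"
  using sets_eq_imp_space_eq[OF bounded_density_sets] by simp

text \<open>Finite Lebesgue measure is demanded because \<open>measure\<close> assigns the value 0
  to sets of infinite measure.\<close>

lemma bounded_density_measure_le:
  "\<exists>D>0. \<forall>S\<in>sets borel. emeasure lborel S < \<infinity> \<longrightarrow> measure \<nu> S \<le> D * measure lborel S"
proof -
  obtain D where D: "\<And>x. \<bar>f x\<bar> \<le> D" using f by (force simp: has_bounded_density_def bounded_iff)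
  have meas[measurable]: "f \<in> borel_measurable borel" using f by (simp add: has_bounded_density_def)
  have \<nu>: "\<nu> = density lborel (\<lambda>x. ennreal (f x))" using f by (simp add: has_bounded_density_def)
  interpret \<nu>: prob_space \<nu> by (rule bounded_density_prob_space)
  have D0: "0 \<le> D" and D': "f x \<le> D + 1" for x using D[of 0] D[of x] by linarith+
  have "measure \<nu> S \<le> (D + 1) * measure lborel S" if S: "S \<in> sets borel" "emeasure lborel S < \<infinity>" for S
  proof -
    have "emeasure \<nu> S = (\<integral>\<^sup>+x. ennreal (f x) * indicator S x \<partial>lborel)"
      unfolding \<nu> using S by (subst emeasure_density) auto
    also have "\<dots> \<le> (\<integral>\<^sup>+x. ennreal (D + 1) * indicator S x \<partial>lborel)"
      using D' by (intro nn_integral_mono mult_right_mono ennreal_leI) auto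
    also have "\<dots> = ennreal (D + 1) * emeasure lborel S"
      using S by (simp add: nn_integral_cmult)
    also have "\<dots> = ennreal ((D + 1) * measure lborel S)"
      using S D0 by (simp add: emeasure_eq_ennreal_measure less_top[symmetric] ennreal_mult)
    finally have "ennreal (measure \<nu> S) \<le> ennreal ((D + 1) * measure lborel S)"
      by (simp add: \<nu>.emeasure_eq_measure)
    then show ?thesis using D0 by (subst (asm) ennreal_le_iff) auto
  qed
  then show ?thesis using D0 by (intro exI[of _ "D + 1"]) auto
qed

text \<open>Comparison with the Euclidean norm puts the ball into a cube of side
  \<open>2 * s / \<kappa>\<close>. Uniformity in the centre allows conditioning on the position of a
  random centre later.\<close>

lemma ball_mass_le:
  assumes N: "is_norm N"
  shows "\<exists>A>0. \<forall>x. \<forall>s>0. measure \<nu> {y. N (y - x) \<le> s} \<le> A * s ^ DIM('a)"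
proof -
  interpret \<nu>: prob_space \<nu> by (rule bounded_density_prob_space)
  obtain \<kappa> where \<kappa>: "\<kappa> > 0" "\<And>x. \<kappa> * norm x \<le> N x" using norm_le_is_norm[OF N] by blast
  obtain D where D: "D > 0"
    "\<And>S. S \<in> sets borel \<Longrightarrow> emeasure lborel S < \<infinity> \<Longrightarrow> measure \<nu> S \<le> D * measure lborel S"
    using bounded_density_measure_le by blast
  have "measure \<nu> {y. N (y - x) \<le> s} \<le> D * (2 / \<kappa>) ^ DIM('a) * s ^ DIM('a)" if s: "s > 0" for x s
  proof -
    let ?u = "(s / \<kappa>) *\<^sub>R (One :: 'a)"
    have sub: "{y. N (y - x) \<le> s} \<subseteq> cbox (x - ?u) (x + ?u)"
    proof
      fix y assume "y \<in> {y. N (y - x) \<le> s}"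
      then have "norm (y - x) \<le> s / \<kappa>" using \<kappa>(2)[of "y - x"] \<kappa>(1) by (simp add: field_simps)
      moreover have "\<bar>(y - x) \<bullet> i\<bar> \<le> norm (y - x)" if "i \<in> Basis" for i
        using that by (rule Basis_le_norm)
      ultimately have "\<bar>(y - x) \<bullet> i\<bar> \<le> s / \<kappa>" if "i \<in> Basis" for i
        using that by fastforce
      then show "y \<in> cbox (x - ?u) (x + ?u)"
        by (force simp: mem_box inner_diff_left inner_add_left abs_le_iff)
    qed
    have "measure \<nu> {y. N (y - x) \<le> s} \<le> measure \<nu> (cbox (x - ?u) (x + ?u))"
      using sub by (intro \<nu>.finite_measure_mono) (auto simp: bounded_density_sets)
    also have "\<dots> \<le> D * measure lborel (cbox (x - ?u) (x + ?u))"
      by (intro D) (auto simp: emeasure_lborel_cbox_eq)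
    also have "measure lborel (cbox (x - ?u) (x + ?u)) = (2 * s / \<kappa>) ^ DIM('a)"
      using s \<kappa>(1)
      by (subst measure_lborel_cbox) (auto simp: inner_diff_left inner_add_left)
    finally show ?thesis by (simp add: power_mult_distrib power_divide)
  qed
  then show ?thesis using D \<kappa> by (intro exI[of _ "D * (2 / \<kappa>) ^ DIM('a)"]) auto
qed

text \<open>The support may be unbounded. The box keeps half of the mass in a region that of order
  \<open>s ^ (- d)\<close> cells of side proportional to \<open>s\<close> can cover.\<close>

lemma half_mass_box: "\<exists>R::real\<ge>1. 1 / 2 \<le> measure \<nu> {x. \<forall>i\<in>Basis. \<bar>x \<bullet> i\<bar> < R}"
proof -
  interpret \<nu>: prob_space \<nu> by (rule bounded_density_prob_space)
  let ?B = "\<lambda>n::nat. {x::'a. \<forall>i\<in>Basis. \<bar>x \<bullet> i\<bar> < real n}"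
  have inc: "incseq ?B" by (fastforce simp: incseq_def)
  have Un: "(\<Union>n. ?B n) = UNIV"
  proof safe
    fix x :: 'a
    obtain n where "norm x < real n" using reals_Archimedean2 by blast
    then have "x \<in> ?B n" using Basis_le_norm[of _ x] by (auto intro: le_less_trans)
    then show "x \<in> (\<Union>n. ?B n)" by blast
  qed simp
  have "(\<lambda>n. measure \<nu> (?B n)) \<longlonglongrightarrow> measure \<nu> (\<Union>n. ?B n)"
    by (intro \<nu>.finite_Lim_measure_incseq inc) (auto simp: bounded_density_sets)
  then have "(\<lambda>n. measure \<nu> (?B n)) \<longlonglongrightarrow> 1"
    using \<nu>.prob_space unfolding Un by (simp add: bounded_density_space)
  then have "\<forall>\<^sub>F n in sequentially. measure \<nu> (?B n) > 1 / 2" by (rule order_tendstoD) simp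
  then have "\<forall>\<^sub>F n in sequentially. measure \<nu> (?B n) > 1 / 2 \<and> n \<ge> 1"
    using eventually_ge_at_top by (rule eventually_conj)
  then obtain n :: nat where "measure \<nu> (?B n) > 1 / 2" "n \<ge> 1"
    using eventually_happens'[OF sequentially_bot] by blast
  then show ?thesis by (intro exI[of _ "real n"]) auto
qed

text \<open>Double counting. At most \<open>M\<close> cells, \<open>M\<close> of order
  \<open>s ^ (- d)\<close>, cover half of the mass. Those lighter than \<open>1 / (4 * M)\<close>
  carry at most a quarter in total, so the others carry at least a quarter. As bounded density
  limits each cell to mass \<open>D * h ^ d\<close>, there must be of order \<open>s ^ (- d)\<close>
  heavy ones.\<close>

lemma heavy_cells:
  assumes N: "is_norm N"
  shows "\<exists>a>0. \<exists>b>0. \<forall>s. 0 < s \<longrightarrow> s \<le> 1 \<longrightarrow>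
    (\<exists>\<Q>. finite \<Q> \<and> disjoint \<Q> \<and> \<Q> \<subseteq> sets borel \<and> b \<le> real (card \<Q>) * s ^ DIM('a) \<and>
      (\<forall>Q\<in>\<Q>. a * s ^ DIM('a) \<le> measure \<nu> Q \<and> (\<forall>x\<in>Q. \<forall>y\<in>Q. N (x - y) \<le> s)))"
proof -
  interpret \<nu>: prob_space \<nu> by (rule bounded_density_prob_space)
  obtain D where D: "D > 0"
    "\<And>S. S \<in> sets borel \<Longrightarrow> emeasure lborel S < \<infinity> \<Longrightarrow> measure \<nu> S \<le> D * measure lborel S"
    using bounded_density_measure_le by blast
  obtain K where K: "K \<ge> 1" "\<And>x. N x \<le> K * norm x" using is_norm_le_norm[OF N] by blast
  obtain R where R: "R \<ge> 1" "1 / 2 \<le> measure \<nu> {x. \<forall>i\<in>Basis. \<bar>x \<bullet> i\<bar> < R}"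
    using half_mass_box by blast
  \<comment> \<open>A cube of side \<open>h\<close> has Euclidean diameter at most
    \<open>d * h\<close> by the l1 bound, hence \<open>N\<close>-diameter at most
    \<open>L * h\<close>; so the side will be \<open>s / L\<close>.\<close>
  define L where "L = K * DIM('a)"
  have L: "L \<ge> 1" unfolding L_def
    using mult_mono[of 1 K 1 "real DIM('a)"] K(1) DIM_positive[where 'a='a] by linarith
  \<comment> \<open>\<open>a * s ^ d\<close> is the threshold \<open>1 / (4 * M)\<close>, and
    \<open>b\<close> is what remains of \<open>1 / 4\<close> after division by the largest possible
    mass of a cell.\<close>
  define a where "a = 1 / (4 * (2 * (R + 1) * L) ^ DIM('a))"
  define b where "b = L ^ DIM('a) / (4 * D)"
  have "\<exists>\<Q>. finite \<Q> \<and> disjoint \<Q> \<and> \<Q> \<subseteq> sets borel \<and> b \<le> real (card \<Q>) * s ^ DIM('a) \<and>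
      (\<forall>Q\<in>\<Q>. a * s ^ DIM('a) \<le> measure \<nu> Q \<and> (\<forall>x\<in>Q. \<forall>y\<in>Q. N (x - y) \<le> s))"
    if s: "0 < s" "s \<le> 1" for s
  proof -
    define h where "h = s / L"
    have h: "0 < h" "h \<le> 1" "L * h = s" using s L by (auto simp: h_def field_simps)
    define T where "T = \<lceil>R / h\<rceil>"
    define Z where "Z = PiE (Basis :: 'a set) (\<lambda>_. {-T..<T})"
    define \<C> where "\<C> = grid_cell h ` Z"
    define M where "M = (2 * (R + 1) / h) ^ DIM('a)"
    have M: "M > 0" using h R by (simp add: M_def)
    have T: "1 \<le> T" "R / h \<le> T" using h R by (auto simp: T_def le_ceiling_iff)
    have "real_of_int T \<le> R / h + 1" unfolding T_def by (rule of_int_ceiling_le_add_one)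
    \<comment> \<open>Here \<open>h \<le> 1\<close> absorbs the rounding in
      \<open>T\<close>.\<close>
    also have "\<dots> \<le> (R + 1) / h" using h by (simp add: field_simps)
    finally have T2: "2 * real_of_int T \<le> 2 * (R + 1) / h" using h by (simp add: field_simps)
    have fin: "finite \<C>" by (simp add: \<C>_def Z_def finite_PiE)
    have "card \<C> \<le> card Z" unfolding \<C>_def by (intro card_image_le) (simp add: Z_def finite_PiE)
    also have "card Z = nat (2 * T) ^ DIM('a)" using T by (simp add: Z_def card_PiE)
    finally have "real (card \<C>) \<le> (2 * real_of_int T) ^ DIM('a)"
      using T by (metis (mono_tags, opaque_lifting) of_int_mult of_int_numeral of_nat_le_iff of_nat_nat of_nat_power int_one_le_iff_zero_less mult_nonneg_nonneg zero_le_numeral order_less_imp_le)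
    also have "\<dots> \<le> M" unfolding M_def using T by (intro power_mono T2) auto
    finally have cardC: "real (card \<C>) \<le> M" .
    have cellsets: "grid_cell h z \<in> sets borel" for z
    proof -
      have "grid_cell h z = {x\<in>space borel. \<forall>i\<in>Basis. \<lfloor>(x \<bullet> i) / h\<rfloor> = z i}" by (simp add: grid_cell_def)
      also have "\<dots> \<in> sets borel" by measurable
      finally show ?thesis .
    qed
    have Csets: "\<C> \<subseteq> sets borel" using cellsets by (auto simp: \<C>_def)
    have dC: "disjoint \<C>"
    proof (rule disjointI)
      fix P Q assume "P \<in> \<C>" "Q \<in> \<C>" "P \<noteq> Q"
      then obtain z w where zw: "z \<in> Z" "w \<in> Z" "P = grid_cell h z" "Q = grid_cell h w" "z \<noteq> w"
        by (auto simp: \<C>_def)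
      then obtain i where "i \<in> Basis" "z i \<noteq> w i" unfolding Z_def by (metis PiE_ext)
      with zw show "P \<inter> Q = {}" by (auto simp: grid_cell_def)
    qed
    have cellbox: "grid_cell h z \<subseteq> cbox (\<Sum>i\<in>Basis. (real_of_int (z i) * h) *\<^sub>R i) (\<Sum>i\<in>Basis. ((real_of_int (z i) + 1) * h) *\<^sub>R i)" for z
    proof
      fix x assume x: "x \<in> grid_cell h z"
      have "real_of_int (z i) * h \<le> x \<bullet> i \<and> x \<bullet> i \<le> (real_of_int (z i) + 1) * h" if "i \<in> Basis" for i
      proof -
        have "\<lfloor>(x \<bullet> i) / h\<rfloor> = z i" using x that by (auto simp: grid_cell_def)
        then have "z i \<le> (x \<bullet> i) / h" "(x \<bullet> i) / h < z i + 1" by linarith+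
        then show ?thesis using h by (simp add: field_simps)
      qed
      then show "x \<in> cbox (\<Sum>i\<in>Basis. (real_of_int (z i) * h) *\<^sub>R i) (\<Sum>i\<in>Basis. ((real_of_int (z i) + 1) * h) *\<^sub>R i)"
        by (auto simp: mem_box)
    qed
    have mass_le: "measure \<nu> Q \<le> D * h ^ DIM('a)" if Q_in: "Q \<in> \<C>" for Q
    proof -
      obtain z where Q: "Q = grid_cell h z" using Q_in by (auto simp: \<C>_def)
      let ?B = "cbox (\<Sum>i\<in>Basis. (real_of_int (z i) * h) *\<^sub>R i) (\<Sum>i\<in>Basis. ((real_of_int (z i) + 1) * h) *\<^sub>R i) :: 'a set"
      have "measure \<nu> Q \<le> measure \<nu> ?B"
        unfolding Q using cellbox by (intro \<nu>.finite_measure_mono) (auto simp: bounded_density_sets)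
      also have "\<dots> \<le> D * measure lborel ?B"
        by (intro D) (auto simp: emeasure_lborel_cbox_eq)
      also have "measure lborel ?B = (\<Prod>i\<in>(Basis::'a set). h)"
        using h by (subst measure_lborel_cbox) (auto simp: inner_diff_left left_diff_distrib[symmetric] intro!: prod.cong)
      finally show ?thesis by simp
    qed
    have diam: "N (x - y) \<le> s" if Q_in: "Q \<in> \<C>" and "x \<in> Q" "y \<in> Q" for x y Q
    proof -
      obtain z where Q: "Q = grid_cell h z" using Q_in by (auto simp: \<C>_def)
      have "\<bar>(x - y) \<bullet> i\<bar> \<le> h" if "i \<in> Basis" for i
      proof -
        have "\<lfloor>(x \<bullet> i) / h\<rfloor> = z i" "\<lfloor>(y \<bullet> i) / h\<rfloor> = z i"
          using that \<open>x \<in> Q\<close> \<open>y \<in> Q\<close> by (auto simp: Q grid_cell_def)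
        then have "\<bar>(x \<bullet> i) / h - (y \<bullet> i) / h\<bar> \<le> 1" by linarith
        then have "\<bar>x \<bullet> i - y \<bullet> i\<bar> / h \<le> 1" using h by (simp add: diff_divide_distrib[symmetric])
        then show ?thesis using h by (simp add: inner_diff_left)
      qed
      then have "norm (x - y) \<le> (\<Sum>i\<in>(Basis::'a set). h)"
        by (intro order_trans[OF norm_le_l1] sum_mono)
      then have "K * norm (x - y) \<le> K * (DIM('a) * h)" using K by (intro mult_left_mono) auto
      then show ?thesis using K(2)[of "x - y"] h by (simp add: L_def mult.assoc)
    qed
    have "{x. \<forall>i\<in>Basis. \<bar>x \<bullet> i\<bar> < R} \<subseteq> \<Union>\<C>"
    proof
      fix x :: 'a assume x: "x \<in> {x. \<forall>i\<in>Basis. \<bar>x \<bullet> i\<bar> < R}"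
      define z where "z = restrict (\<lambda>i. \<lfloor>(x \<bullet> i) / h\<rfloor>) (Basis :: 'a set)"
      have "\<lfloor>(x \<bullet> i) / h\<rfloor> \<in> {-T..<T}" if "i \<in> Basis" for i
      proof -
        have "\<bar>x \<bullet> i\<bar> < R" using x that by auto
        then have "- (R / h) < (x \<bullet> i) / h" "(x \<bullet> i) / h < R / h" using h by (auto simp: field_simps)
        then have "- real_of_int T < (x \<bullet> i) / h" "(x \<bullet> i) / h < real_of_int T" using T(2) by linarith+
        then show ?thesis by (auto simp: le_floor_iff floor_less_iff)
      qed
      then have "z \<in> Z" by (auto simp: Z_def z_def)
      moreover have "x \<in> grid_cell h z" by (auto simp: grid_cell_def z_def)
      ultimately show "x \<in> \<Union>\<C>" by (auto simp: \<C>_def)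
    qed
    then have "1 / 2 \<le> measure \<nu> (\<Union>\<C>)"
      using Csets fin R(2) by (intro order_trans[OF R(2)] \<nu>.finite_measure_mono)
        (auto simp: bounded_density_sets intro!: sets.finite_Union)
    also have "\<dots> = (\<Sum>Q\<in>\<C>. measure \<nu> Q)"
      using \<nu>.finite_measure_finite_Union[of \<C> "\<lambda>Q. Q"] Csets fin dC
      by (auto simp: bounded_density_sets disjoint_def disjoint_family_on_def)
    finally have half: "1 / 2 \<le> (\<Sum>Q\<in>\<C>. measure \<nu> Q)" .
    define \<Q> where "\<Q> = {Q\<in>\<C>. 1 / (4 * M) \<le> measure \<nu> Q}"
    \<comment> \<open>The light cells: at most \<open>M\<close> of them, each of mass below
      \<open>1 / (4 * M)\<close>.\<close>
    have "(\<Sum>Q\<in>\<C> - \<Q>. measure \<nu> Q) \<le> (\<Sum>Q\<in>\<C> - \<Q>. 1 / (4 * M))"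
      by (intro sum_mono) (auto simp: \<Q>_def)
    also have "\<dots> \<le> (\<Sum>Q\<in>\<C>. 1 / (4 * M))" using fin M by (intro sum_mono2) auto
    also have "\<dots> \<le> 1 / 4" using cardC M by (simp add: field_simps)
    finally have "1 / 4 \<le> (\<Sum>Q\<in>\<Q>. measure \<nu> Q)"
      using half sum.subset_diff[of \<Q> \<C> "measure \<nu>"] fin by (auto simp: \<Q>_def)
    also have "\<dots> \<le> (\<Sum>Q\<in>\<Q>. D * h ^ DIM('a))" by (intro sum_mono mass_le) (auto simp: \<Q>_def)
    finally have "1 / 4 \<le> card \<Q> * (D * h ^ DIM('a))" by simp
    then have "b \<le> real (card \<Q>) * s ^ DIM('a)"
      using D L by (simp add: b_def h_def power_divide field_simps)
    moreover have "a * s ^ DIM('a) = 1 / (4 * M)"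
      using h L R s by (simp add: a_def M_def h_def power_divide power_mult_distrib field_simps)
    then have "\<forall>Q\<in>\<Q>. a * s ^ DIM('a) \<le> measure \<nu> Q" by (simp add: \<Q>_def)
    moreover have "disjoint \<Q>" using dC by (auto simp: disjoint_def \<Q>_def)
    ultimately show ?thesis using fin Csets diam by (intro exI[of _ \<Q>]) (auto simp: \<Q>_def)
  qed
  moreover have "a > 0" "b > 0" using L R D by (auto simp: a_def b_def)
  ultimately show ?thesis by blast
qed

end

section \<open>Cliques and independent events\<close>

lemma card_le_clique_number:
  assumes "finite V" "S \<subseteq> V" "clique S E"
  shows "card S \<le> clique_number V E"
  unfolding clique_number_def using assms by (intro Max_ge) auto

lemma clique_number_attained:
  assumes "finite V"
  obtains S where "S \<subseteq> V" "clique S E" "card S = clique_number V E"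
proof -
  have "finite {card S | S. S \<subseteq> V \<and> clique S E}" "{card S | S. S \<subseteq> V \<and> clique S E} \<noteq> {}"
    using assms by (auto simp: clique_def)
  from Max_in[OF this] that show thesis by (auto simp: clique_number_def)
qed

text \<open>Subsets of cliques are cliques, so cliques with exactly \<open>k\<close> vertices
  suffice. This turns the tail of the clique number into a finite union of events.\<close>

lemma clique_number_ge_iff:
  assumes "finite V"
  shows "k \<le> clique_number V E \<longleftrightarrow> (\<exists>S\<subseteq>V. card S = k \<and> clique S E)"
proof
  assume k: "k \<le> clique_number V E"
  obtain S where S: "S \<subseteq> V" "clique S E" "card S = clique_number V E"
    using clique_number_attained[OF assms] .
  with k obtain T where "T \<subseteq> S" "card T = k" by (metis obtain_subset_with_card_n)
  with S show "\<exists>S\<subseteq>V. card S = k \<and> clique S E" by (intro exI[of _ T]) (auto simp: clique_def)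
qed (use card_le_clique_number[OF assms] in auto)

text \<open>If no vertex of the clique has many neighbours at distance at most \<open>s\<close>, then
  the clique contains quadratically many far pairs, and those must have been inserted.\<close>

lemma perturbed_clique_dichotomy:
  fixes N :: "'a::euclidean_space \<Rightarrow> real"
  assumes N: "is_norm N"
    and cl: "clique S (perturb {..<n} del ins (rgg_edges N s n x))"
    and S: "S \<subseteq> {..<n}" "card S = 2 * j"
  shows "(\<exists>v\<in>S. \<exists>J\<subseteq>S - {v}. card J = j \<and> (\<forall>u\<in>J. N (x u - x v) \<le> s)) \<or>
    (\<exists>F\<subseteq>[S]\<^bsup>2\<^esup>. card F = j\<^sup>2 \<and> (\<forall>e\<in>F. ins e))"
  unfolding disj_imp
proof (rule impI)
  assume no: "\<not> (\<exists>v\<in>S. \<exists>J\<subseteq>S - {v}. card J = j \<and> (\<forall>u\<in>J. N (x u - x v) \<le> s))"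
  have finS: "finite S" using S finite_subset by blast
  \<comment> \<open>The vertices of \<open>S\<close> far from \<open>v\<close>: of the
    \<open>2 * j - 1\<close> others fewer than \<open>j\<close> are near, so at least
    \<open>j\<close> are far.\<close>
  define T where "T v = {u\<in>S - {v}. \<not> N (x u - x v) \<le> s}" for v
  have T: "j \<le> card (T v)" if v: "v \<in> S" for v
  proof -
    let ?C = "{u\<in>S - {v}. N (x u - x v) \<le> s}"
    have "card ?C < j"
    proof (rule ccontr)
      assume "\<not> card ?C < j"
      then have "j \<le> card ?C" by simp
      then obtain J where "J \<subseteq> ?C" "card J = j"
        by (rule obtain_subset_with_card_n)
      then show False using no v by blast
    qed
    moreover have "card ?C + card (T v) = card (S - {v})"
      using finS by (subst card_Un_disjoint[symmetric]) (auto simp: T_def intro!: arg_cong[where f=card])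
    ultimately show ?thesis using S v finS by (simp add: card_Diff_singleton_if)
  qed
  define F where "F = (\<lambda>(v, u). {v, u}) ` (SIGMA v:S. T v)"
  \<comment> \<open>The far ordered pairs number at least \<open>2 * j * j\<close>, and each
    unordered pair arises from at most two of them.\<close>
  have "2 * j * j \<le> (\<Sum>v\<in>S. card (T v))"
    using sum_bounded_below[of S j "\<lambda>v. card (T v)"] T S by simp
  also have "\<dots> = card (SIGMA v:S. T v)" using finS by (subst card_SigmaI) (auto simp: T_def)
  also have "\<dots> \<le> card (\<Union>e\<in>F. {p\<in>Sigma S T. (\<lambda>(v, u). {v, u}) p = e})"
    using finS by (intro card_mono) (auto simp: F_def T_def)
  also have "\<dots> \<le> (\<Sum>e\<in>F. card {p\<in>Sigma S T. (\<lambda>(v, u). {v, u}) p = e})"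
    using finS by (intro card_UN_le) (auto simp: F_def T_def)
  also have "\<dots> \<le> (\<Sum>e\<in>F. 2)"
  proof (rule sum_mono)
    fix e assume "e \<in> F"
    then obtain v u where e: "e = {v, u}" by (auto simp: F_def)
    have "{p\<in>Sigma S T. (\<lambda>(v, u). {v, u}) p = e} \<subseteq> {(v, u), (u, v)}"
    proof
      fix p assume "p \<in> {p\<in>Sigma S T. (\<lambda>(v, u). {v, u}) p = e}"
      moreover obtain a b where "p = (a, b)" by (cases p)
      ultimately have "{a, b} = {v, u}" "p = (a, b)" by (simp_all add: e)
      then show "p \<in> {(v, u), (u, v)}" unfolding doubleton_eq_iff by blast
    qed
    then have "card {p\<in>Sigma S T. (\<lambda>(v, u). {v, u}) p = e} \<le> card {(v, u), (u, v)}"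
      by (rule card_mono[rotated]) simp
    also have "\<dots> \<le> 2" by (cases "u = v") auto
    finally show "card {p\<in>Sigma S T. (\<lambda>(v, u). {v, u}) p = e} \<le> 2" .
  qed
  finally have "j\<^sup>2 \<le> card F" by (simp add: power2_eq_square)
  moreover have "F \<subseteq> [S]\<^bsup>2\<^esup>" by (auto simp: F_def T_def)
  moreover have "ins e" if e_in: "e \<in> F" for e
  proof -
    obtain v u where e: "e = {v, u}" "v \<in> S" "u \<in> S" "u \<noteq> v" "\<not> N (x u - x v) \<le> s"
      using e_in by (auto simp: F_def T_def)
    then have mem: "{u, v} \<in> perturb {..<n} del ins (rgg_edges N s n x)" "{u, v} = e"
      using cl by (auto simp: clique_def)
    show ?thesis
    proof (cases "e \<in> rgg_edges N s n x")
      case False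
      with mem show ?thesis by (auto simp: perturb_def)
    next
      case True
      then have "N (x u - x v) \<le> s"
        using e is_norm_minus_commute[OF N] by (auto simp: rgg_edges_def doubleton_eq_iff)
      with e show ?thesis by blast
    qed
  qed
  \<comment> \<open>Cutting down to exactly \<open>j\<^sup>2\<close> pairs fixes the exponent of
    \<open>q\<close> in the union bound.\<close>
  moreover obtain F' where "F' \<subseteq> F" "card F' = j\<^sup>2"
    by (rule obtain_subset_with_card_n[OF \<open>j\<^sup>2 \<le> card F\<close>])
  ultimately show "\<exists>F\<subseteq>[S]\<^bsup>2\<^esup>. card F = j\<^sup>2 \<and> (\<forall>e\<in>F. ins e)"
    by (intro exI[of _ F']) blast
qed

section \<open>Independence of blocks and a second moment inequality\<close>

context prob_space begin

text \<open>Passing only the restriction of the family to \<open>K j\<close> to the predicate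
  expresses that the \<open>j\<close>-th event depends on its own block; disjoint blocks are
  independent. It is applied to the coins joining different vertices to a set and to groups of
  points.\<close>

lemma prob_indep_blocks:
  assumes indep: "indep_vars M' X I" and K: "\<And>j. j \<in> L \<Longrightarrow> K j \<subseteq> I" "disjoint_family_on K L"
    and L: "finite L"
    and meas: "\<And>j. j \<in> L \<Longrightarrow> {x\<in>space (PiM (K j) M'). P j x} \<in> sets (PiM (K j) M')"
  shows "prob {\<omega>\<in>space M. \<forall>j\<in>L. P j (\<lambda>i\<in>K j. X i \<omega>)} =
    (\<Prod>j\<in>L. prob {\<omega>\<in>space M. P j (\<lambda>i\<in>K j. X i \<omega>)})"
\<comment> \<open>For empty \<open>L\<close> the intersection of the events would be
  \<open>UNIV\<close> instead of \<open>space M\<close>.\<close>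
proof (cases "L = {}")
  case False
  have "indep_events (\<lambda>j. {\<omega>\<in>space M. P j (\<lambda>i\<in>K j. X i \<omega>)}) L"
    using indep_eventsI_indep_vars[OF indep_vars_restrict[OF indep K], of P] meas by simp
  then have "prob (\<Inter>j\<in>L. {\<omega>\<in>space M. P j (\<lambda>i\<in>K j. X i \<omega>)}) =
      (\<Prod>j\<in>L. prob {\<omega>\<in>space M. P j (\<lambda>i\<in>K j. X i \<omega>)})"
    using False L by (auto simp: indep_events_def)
  also have "(\<Inter>j\<in>L. {\<omega>\<in>space M. P j (\<lambda>i\<in>K j. X i \<omega>)}) =
      {\<omega>\<in>space M. \<forall>j\<in>L. P j (\<lambda>i\<in>K j. X i \<omega>)}" using False by auto
  finally show ?thesis .
qed (simp add: prob_space)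

lemma prob_indep_vars_all:
  assumes indep: "indep_vars M' X I" and J: "J \<subseteq> I" "finite J"
    and meas: "\<And>j. j \<in> J \<Longrightarrow> A j \<in> sets (M' j)"
  shows "prob {\<omega>\<in>space M. \<forall>j\<in>J. X j \<omega> \<in> A j} = (\<Prod>j\<in>J. prob {\<omega>\<in>space M. X j \<omega> \<in> A j})"
proof (cases "J = {}")
  case False
  have "prob (\<Inter>j\<in>J. X j -` A j \<inter> space M) = (\<Prod>j\<in>J. prob (X j -` A j \<inter> space M))"
    by (rule indep_varsD[OF indep]) (use False J meas in auto)
  moreover have "(\<Inter>j\<in>J. X j -` A j \<inter> space M) = {\<omega>\<in>space M. \<forall>j\<in>J. X j \<omega> \<in> A j}"
    using False by auto
  moreover have "X j -` A j \<inter> space M = {\<omega>\<in>space M. X j \<omega> \<in> A j}" for j by auto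
  ultimately show ?thesis by simp
qed (simp add: prob_space)

text \<open>Chebyshev's inequality for the number \<open>Z\<close> of events that occur. Negative
  correlation bounds its variance by its mean \<open>\<mu>\<close>, while
  \<open>(Z - \<mu>)\<^sup>2 = \<mu>\<^sup>2\<close> where no event occurs. The product form needs
  no division by \<open>\<mu>\<close>.\<close>

lemma neg_correlated_second_moment:
  assumes I: "finite I" and E: "\<And>i. i \<in> I \<Longrightarrow> E i \<in> events"
    and neg: "\<And>i j. i \<in> I \<Longrightarrow> j \<in> I \<Longrightarrow> i \<noteq> j \<Longrightarrow> prob (E i \<inter> E j) \<le> prob (E i) * prob (E j)"
  shows "prob (space M - (\<Union>i\<in>I. E i)) * (\<Sum>i\<in>I. prob (E i)) \<le> 1"
proof -
  define \<mu> where "\<mu> = (\<Sum>i\<in>I. prob (E i))"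
  define Z where "Z \<omega> = (\<Sum>i\<in>I. indicator (E i) \<omega> :: real)" for \<omega>
  define W where "W = space M - (\<Union>i\<in>I. E i)"
  have W: "W \<in> events" using I E unfolding W_def by (intro sets.Diff sets.top sets.finite_UN) auto
  have int: "integrable M (indicator A :: _ \<Rightarrow> real)" if "A \<in> events" for A
    using that by (simp add: integrable_indicator_iff less_top[symmetric])
  have eq: "(Z \<omega> - \<mu>)\<^sup>2 = (\<Sum>i\<in>I. \<Sum>j\<in>I. indicator (E i \<inter> E j) \<omega>) - 2 * \<mu> * (\<Sum>i\<in>I. indicator (E i) \<omega>) + \<mu>\<^sup>2" for \<omega>
    unfolding indicator_inter_arith sum_product[symmetric]
    by (simp add: Z_def power2_eq_square algebra_simps)
  have "\<mu>\<^sup>2 * prob W = (\<integral>\<omega>. \<mu>\<^sup>2 * indicator W \<omega> \<partial>M)" using W by simp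
  also have "\<dots> \<le> (\<integral>\<omega>. (Z \<omega> - \<mu>)\<^sup>2 \<partial>M)"
  proof (rule integral_mono)
    show "integrable M (\<lambda>\<omega>. \<mu>\<^sup>2 * indicator W \<omega>)" using W int by auto
    show "integrable M (\<lambda>\<omega>. (Z \<omega> - \<mu>)\<^sup>2)" unfolding eq using E
      by (intro Bochner_Integration.integrable_add Bochner_Integration.integrable_diff
          Bochner_Integration.integrable_sum integrable_mult_right int) auto
    fix \<omega> show "\<mu>\<^sup>2 * indicator W \<omega> \<le> (Z \<omega> - \<mu>)\<^sup>2"
      by (auto simp: indicator_def Z_def W_def)
  qed
  also have "\<dots> = (\<Sum>i\<in>I. \<Sum>j\<in>I. prob (E i \<inter> E j)) - 2 * \<mu> * \<mu> + \<mu>\<^sup>2"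
    unfolding eq using E int by (simp add: \<mu>_def prob_space sets.Int)
  \<comment> \<open>Only the diagonal can exceed the products, by at most \<open>prob (E i)\<close>
    each.\<close>
  also have "(\<Sum>i\<in>I. \<Sum>j\<in>I. prob (E i \<inter> E j)) \<le>
      (\<Sum>i\<in>I. \<Sum>j\<in>I. prob (E i) * prob (E j) + (if i = j then prob (E i) else 0))"
    using neg by (intro sum_mono) auto
  also have "\<dots> = \<mu> * \<mu> + \<mu>" using I by (simp add: \<mu>_def sum.distrib sum_product)
  finally have le: "\<mu>\<^sup>2 * prob W \<le> \<mu>" by (simp add: power2_eq_square)
  have "prob W * \<mu> \<le> 1"
  proof (cases "\<mu> = 0")
    case False
    then have "\<mu> > 0" using sum_nonneg[of I "\<lambda>i. prob (E i)"] by (simp add: \<mu>_def)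
    with le show ?thesis by (simp add: power2_eq_square mult.commute)
  qed simp
  then show ?thesis by (simp add: W_def \<mu>_def)
qed

end

section \<open>Estimates for a fixed number of points\<close>

locale noisy_rgg =
  fixes M :: "'w measure" and N :: "'a::euclidean_space \<Rightarrow> real" and \<nu> :: "'a measure"
    and f :: "'a \<Rightarrow> real" and r :: "nat \<Rightarrow> real" and X :: "nat \<Rightarrow> 'w \<Rightarrow> 'a"
    and q :: "nat \<Rightarrow> real" and del ins :: "nat \<Rightarrow> nat set \<Rightarrow> 'w \<Rightarrow> bool"
  assumes N: "is_norm N" and f: "has_bounded_density \<nu> f"
    and q: "\<And>n. 0 \<le> q n \<and> q n \<le> 1"
    and model: "noisy_rgg_model M \<nu> X (\<lambda>_. 0) q del ins"
begin

sublocale prob_space M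
  using model by (simp add: noisy_rgg_model_def)

abbreviation "\<xi> \<equiv> noisy_clique_number N r X del ins"

abbreviation "noisy_edges n \<omega> \<equiv>
  perturb {..<n} (\<lambda>e. del n e \<omega>) (\<lambda>e. ins n e \<omega>) (rgg_edges N (r n) n (\<lambda>i. X i \<omega>))"

lemma X_indep: "indep_vars (\<lambda>_. borel) X UNIV" and X_distr: "distr M borel (X i) = \<nu>"
  using model by (auto simp: noisy_rgg_model_def)

lemma X_measurable [measurable]: "X i \<in> borel_measurable M"
  using X_indep by (auto simp: indep_vars_def)

lemma del_measurable [measurable]: "e \<in> [{..<n}]\<^bsup>2\<^esup> \<Longrightarrow> del n e \<in> measurable M (count_space UNIV)"
  and ins_measurable [measurable]: "e \<in> [{..<n}]\<^bsup>2\<^esup> \<Longrightarrow> ins n e \<in> measurable M (count_space UNIV)"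
  and prob_del: "e \<in> [{..<n}]\<^bsup>2\<^esup> \<Longrightarrow> prob {\<omega>\<in>space M. del n e \<omega>} = 0"
  and prob_ins: "e \<in> [{..<n}]\<^bsup>2\<^esup> \<Longrightarrow> prob {\<omega>\<in>space M. ins n e \<omega>} = q n"
  using model by (auto simp: noisy_rgg_model_def)

declare is_norm_measurable[OF N, measurable]

lemma prob_X: "A \<in> sets borel \<Longrightarrow> prob {\<omega>\<in>space M. X i \<omega> \<in> A} = measure \<nu> A"
  by (subst X_distr[of i, symmetric], subst measure_distr) (auto intro!: arg_cong[where f=prob])

text \<open>The model speaks of event families indexed by \<open>source\<close>;
  \<open>Insertion\<close> is injective, so the families of insertion events can be reindexed by
  pairs.\<close>

lemma ins_indep: "indep_vars (\<lambda>_. count_space UNIV) (ins n) ([{..<n}]\<^bsup>2\<^esup>)"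
  unfolding indep_vars_def2
proof (intro conjI ballI)
  let ?E = "[{..<n}]\<^bsup>2\<^esup>"
  let ?F = "source_events M X (del n) (ins n)"
  have indep: "indep_sets ?F (Insertion ` ?E)"
    using model by (auto simp: noisy_rgg_model_def intro: indep_sets_mono_index[rotated])
  show "indep_sets (\<lambda>e. {ins n e -` A \<inter> space M |A. A \<in> sets (count_space UNIV)}) ?E"
  proof (rule indep_setsI)
    fix A J assume J: "J \<noteq> {}" "J \<subseteq> ?E" "finite J"
      and A: "\<forall>j\<in>J. A j \<in> {ins n j -` A \<inter> space M |A. A \<in> sets (count_space UNIV)}"
    \<comment> \<open>Carries the chosen events over to sources; the value at the other sources is a
      dummy.\<close>
    define A' where "A' s = (case s of Insertion e \<Rightarrow> A e | _ \<Rightarrow> {})" for s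
    have inj: "inj_on Insertion J" by (auto simp: inj_on_def)
    have "prob (\<Inter>s\<in>Insertion ` J. A' s) = (\<Prod>s\<in>Insertion ` J. prob (A' s))"
      by (rule indep_setsD[OF indep]) (use J A in \<open>auto simp: A'_def\<close>)
    then show "prob (\<Inter>j\<in>J. A j) = (\<Prod>j\<in>J. prob (A j))"
      by (simp add: prod.reindex[OF inj] A'_def)
  qed auto
qed auto

lemma prob_all_ins:
  assumes F: "F \<subseteq> [{..<n}]\<^bsup>2\<^esup>"
  shows "prob {\<omega>\<in>space M. \<forall>e\<in>F. ins n e \<omega>} = q n ^ card F"
proof -
  have fin: "finite F" using F finite_subset finite_imp_finite_nsets by blast
  have "prob {\<omega>\<in>space M. \<forall>e\<in>F. ins n e \<omega> \<in> {True}} = (\<Prod>e\<in>F. prob {\<omega>\<in>space M. ins n e \<omega> \<in> {True}})"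
    by (rule prob_indep_vars_all[OF ins_indep F fin]) auto
  also have "\<dots> = (\<Prod>e\<in>F. q n)" using F prob_ins by (intro prod.cong) auto
  finally show ?thesis by simp
qed

text \<open>Deletion probability 0 excludes deletions only almost surely. The lower bounds therefore
  compare events up to null sets.\<close>

lemma AE_no_del: "AE \<omega> in M. \<forall>e\<in>[{..<n}]\<^bsup>2\<^esup>. \<not> del n e \<omega>"
proof (rule AE_finite_allI)
  fix e assume e: "e \<in> [{..<n}]\<^bsup>2\<^esup>"
  then have "emeasure M {\<omega>\<in>space M. del n e \<omega>} = 0"
    by (simp add: emeasure_eq_measure prob_del)
  with e show "AE \<omega> in M. \<not> del n e \<omega>" by (subst AE_iff_measurable[OF _ refl]) auto
qed (simp add: finite_imp_finite_nsets)

text \<open>For fixed \<open>S\<close> being a clique is a finite conjunction of conditions on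
  single pairs, each of which depends measurably on two points and two coins.\<close>

lemma clique_sets [measurable]:
  assumes S: "S \<subseteq> {..<n}"
  shows "Measurable.pred M (\<lambda>\<omega>. clique S (noisy_edges n \<omega>))"
proof -
  have fin: "finite S" using S finite_subset by blast
  have "clique S (noisy_edges n \<omega>) \<longleftrightarrow> (\<forall>v\<in>S. \<forall>w\<in>S - {v}. if N (X v \<omega> - X w \<omega>) \<le> r n
      then \<not> del n {v, w} \<omega> else ins n {v, w} \<omega>)" (is "_ \<longleftrightarrow> ?R \<omega>") for \<omega>
  proof -
    have "{v, w} \<in> rgg_edges N (r n) n (\<lambda>i. X i \<omega>) \<longleftrightarrow> N (X v \<omega> - X w \<omega>) \<le> r n"
      if "v \<in> S" "w \<in> S" "v \<noteq> w" for v w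
      using that S is_norm_minus_commute[OF N] by (auto simp: rgg_edges_def doubleton_eq_iff)
    then show ?thesis using S by (auto simp: clique_def perturb_def)
  qed
  moreover have "Measurable.pred M ?R"
  proof (intro pred_intros_finite fin finite_Diff)
    fix v w assume "v \<in> S" "w \<in> S - {v}"
    then have [measurable]: "{v, w} \<in> [{..<n}]\<^bsup>2\<^esup>" using S by auto
    show "Measurable.pred M (\<lambda>\<omega>. if N (X v \<omega> - X w \<omega>) \<le> r n then \<not> del n {v, w} \<omega> else ins n {v, w} \<omega>)"
      by measurable
  qed
  ultimately show ?thesis by simp
qed

lemma clique_number_sets [measurable]:
  "Measurable.pred M (\<lambda>\<omega>. k \<le> clique_number {..<n} (noisy_edges n \<omega>))"
proof -
  have "k \<le> clique_number {..<n} (noisy_edges n \<omega>) \<longleftrightarrow>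
      (\<exists>S\<in>{S. S \<subseteq> {..<n} \<and> card S = k}. clique S (noisy_edges n \<omega>))" for \<omega>
    by (subst clique_number_ge_iff) auto
  moreover have "Measurable.pred M (\<lambda>\<omega>. \<exists>S\<in>{S. S \<subseteq> {..<n} \<and> card S = k}. clique S (noisy_edges n \<omega>))"
    by (intro pred_intros_finite) auto
  ultimately show ?thesis by simp
qed

lemma noisy_clique_number_measurable [measurable]: "\<xi> n \<in> borel_measurable M"
proof -
  have "(\<lambda>\<omega>. clique_number {..<n} (noisy_edges n \<omega>)) \<in> measurable M (count_space UNIV)"
  proof (subst measurable_count_space_eq2_countable, safe)
    fix k :: nat
    have "{\<omega>\<in>space M. k \<le> clique_number {..<n} (noisy_edges n \<omega>) \<and>
        \<not> Suc k \<le> clique_number {..<n} (noisy_edges n \<omega>)} \<in> sets M" by measurable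
    also have "{\<omega>\<in>space M. k \<le> clique_number {..<n} (noisy_edges n \<omega>) \<and>
        \<not> Suc k \<le> clique_number {..<n} (noisy_edges n \<omega>)} =
        (\<lambda>\<omega>. clique_number {..<n} (noisy_edges n \<omega>)) -` {k} \<inter> space M" by auto
    finally show "(\<lambda>\<omega>. clique_number {..<n} (noisy_edges n \<omega>)) -` {k} \<inter> space M \<in> sets M" .
  qed auto
  then have "(\<lambda>\<omega>. real (clique_number {..<n} (noisy_edges n \<omega>))) \<in> borel_measurable M"
    by (rule measurable_compose) simp
  then show ?thesis by (simp add: noisy_clique_number_def[abs_def])
qed

text \<open>The events for different \<open>u\<close> share the point \<open>X v\<close>. Given its
  position \<open>y\<close>, however, they are independent, and each asks a point to fall into one
  ball around \<open>y\<close>, which has mass at most \<open>p\<close> for every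
  \<open>y\<close>.\<close>

lemma prob_all_near:
  assumes p: "\<And>x. measure \<nu> {y. N (y - x) \<le> s} \<le> p" and J: "finite J" "v \<notin> J"
  shows "prob {\<omega>\<in>space M. \<forall>u\<in>J. N (X u \<omega> - X v \<omega>) \<le> s} \<le> p ^ card J"
proof -
  interpret \<nu>: prob_space \<nu> by (rule bounded_density_prob_space[OF f])
  interpret P: product_prob_space "\<lambda>_::nat. \<nu>" by unfold_locales
  have sets_\<nu>[measurable_cong, simp]: "sets \<nu> = sets borel" by (rule bounded_density_sets[OF f])
  let ?I = "insert v J"
  have p0: "0 \<le> p" using p[of 0] measure_nonneg[of \<nu>] by (rule order_trans[rotated])
  have PiM_cong: "sets (PiM ?I (\<lambda>_. borel :: 'a measure)) = sets (PiM ?I (\<lambda>_. \<nu>))"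
    by (intro sets_PiM_cong) auto
  have distr: "distr M (PiM ?I (\<lambda>_. borel)) (\<lambda>\<omega>. \<lambda>i\<in>?I. X i \<omega>) = PiM ?I (\<lambda>_. \<nu>)"
    using indep_vars_iff_distr_eq_PiM'[where I = ?I and M' = "\<lambda>_. borel" and X = X] indep_vars_subset[OF X_indep, of ?I]
    by (simp add: X_distr)
  define B where "B = {x\<in>space (PiM ?I (\<lambda>_. borel)). \<forall>u\<in>J. N (x u - x v) \<le> s}"
  have B[measurable]: "B \<in> sets (PiM ?I (\<lambda>_. borel))"
    unfolding B_def using J by measurable
  have B': "B \<in> sets (PiM ?I (\<lambda>_. \<nu>))" using B PiM_cong by simp
  have "{\<omega>\<in>space M. \<forall>u\<in>J. N (X u \<omega> - X v \<omega>) \<le> s} = (\<lambda>\<omega>. \<lambda>i\<in>?I. X i \<omega>) -` B \<inter> space M"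
    by (auto simp: B_def space_PiM)
  then have "emeasure M {\<omega>\<in>space M. \<forall>u\<in>J. N (X u \<omega> - X v \<omega>) \<le> s} = emeasure (PiM ?I (\<lambda>_. \<nu>)) B"
    by (simp add: distr[symmetric] emeasure_distr)
  also have "\<dots> = (\<integral>\<^sup>+x. indicator B x \<partial>PiM ?I (\<lambda>_. \<nu>))" using B' by simp
  \<comment> \<open>Fubini with the coordinate \<open>v\<close> outermost: for fixed
    \<open>y\<close> the inner set is a product of equal balls.\<close>
  also have "\<dots> = (\<integral>\<^sup>+y. (\<integral>\<^sup>+x. indicator B (x(v := y)) \<partial>PiM J (\<lambda>_. \<nu>)) \<partial>\<nu>)"
    using J B' by (intro P.product_nn_integral_insert_rev) auto
  also have "\<dots> \<le> (\<integral>\<^sup>+y. ennreal (p ^ card J) \<partial>\<nu>)"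
  proof (rule nn_integral_mono)
    fix y :: 'a
    have ball: "{z. N (z - y) \<le> s} \<in> sets borel"
      using measurable_sets_borel[of "\<lambda>z. N (z - y)" borel "{..s}"] by (simp add: vimage_def)
    have "(\<integral>\<^sup>+x. indicator B (x(v := y)) \<partial>PiM J (\<lambda>_. \<nu>)) =
        (\<integral>\<^sup>+x. indicator (PiE J (\<lambda>_. {z. N (z - y) \<le> s})) x \<partial>PiM J (\<lambda>_. \<nu>))"
    proof (rule nn_integral_cong)
      fix x assume "x \<in> space (PiM J (\<lambda>_. \<nu>))"
      then show "indicator B (x(v := y)) = (indicator (PiE J (\<lambda>_. {z. N (z - y) \<le> s})) x :: ennreal)"
        using J by (auto simp: indicator_def B_def space_PiM PiE_iff extensional_def split: if_splits)
    qed
    also have "\<dots> = emeasure (PiM J (\<lambda>_. \<nu>)) (PiE J (\<lambda>_. {z. N (z - y) \<le> s}))"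
      using J ball by (intro nn_integral_indicator sets_PiM_I_finite) auto
    also have "\<dots> = (\<Prod>u\<in>J. emeasure \<nu> {z. N (z - y) \<le> s})"
      using J ball by (intro P.emeasure_PiM) auto
    also have "\<dots> = ennreal (measure \<nu> {z. N (z - y) \<le> s} ^ card J)"
      by (simp add: \<nu>.emeasure_eq_measure ennreal_power)
    also have "\<dots> \<le> ennreal (p ^ card J)" using p by (intro ennreal_leI power_mono) auto
    finally show "(\<integral>\<^sup>+x. indicator B (x(v := y)) \<partial>PiM J (\<lambda>_. \<nu>)) \<le> ennreal (p ^ card J)" .
  qed
  also have "\<dots> = ennreal (p ^ card J)" by (simp add: \<nu>.emeasure_space_1)
  finally show ?thesis using p0 by (simp add: emeasure_eq_measure)
qed

text \<open>A union bound over both alternatives of the dichotomy: centre and near set in the first,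
  clique and set of inserted pairs in the second. The binomial coefficient is kept because its
  factorial later yields the division by \<open>j\<close>.\<close>

lemma prob_clique_number_ge:
  assumes p: "\<And>x. measure \<nu> {y. N (y - x) \<le> r n} \<le> p"
  shows "prob {\<omega>\<in>space M. real (2 * j) \<le> \<xi> n \<omega>} \<le>
    real n * real (n choose j) * p ^ j + real n ^ (2 * j) * (4 * q n) ^ j\<^sup>2"
proof -
  have p0: "0 \<le> p" using p[of 0] measure_nonneg[of \<nu>] by (rule order_trans[rotated])
  define I1 where "I1 = {(v, J). v < n \<and> J \<in> [{..<n}]\<^bsup>j\<^esup> \<and> v \<notin> J}"
  define I2 where "I2 = (SIGMA S:nsets {..<n} (2 * j). nsets ([S]\<^bsup>2\<^esup>) (j\<^sup>2))"
  define A1 where "A1 = (\<lambda>(v, J). {\<omega>\<in>space M. \<forall>u\<in>J. N (X u \<omega> - X v \<omega>) \<le> r n})"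
  define A2 where "A2 = (\<lambda>(S :: nat set, F). {\<omega>\<in>space M. \<forall>e\<in>F. ins n e \<omega>})"
  have I1_sub: "I1 \<subseteq> {..<n} \<times> [{..<n}]\<^bsup>j\<^esup>" by (auto simp: I1_def)
  have fin1: "finite I1" using I1_sub by (rule finite_subset) (simp add: finite_imp_finite_nsets)
  have "card I1 \<le> card ({..<n} \<times> [{..<n}]\<^bsup>j\<^esup>)"
    using I1_sub by (intro card_mono) (auto simp: finite_imp_finite_nsets)
  then have card1: "card I1 \<le> n * (n choose j)" by (simp add: card_cartesian_product)
  have finS: "finite (nsets ([S]\<^bsup>2\<^esup>) (j\<^sup>2))" if "S \<in> nsets {..<n} (2 * j)" for S
    using that by (intro finite_imp_finite_nsets) (auto simp: nsets_def)
  have fin2: "finite I2" unfolding I2_def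
    using finS by (intro finite_SigmaI) (auto simp: finite_imp_finite_nsets)
  have F_sub: "F \<subseteq> [{..<n}]\<^bsup>2\<^esup>" "card F = j\<^sup>2" "finite F" if "(S, F) \<in> I2" for S F
    using that nsets_mono[of S "{..<n}" 2] by (auto simp: I2_def nsets_def)
  have card2: "real (card I2) \<le> real n ^ (2 * j) * 4 ^ j\<^sup>2"
  proof -
    have "card I2 = (\<Sum>S\<in>nsets {..<n} (2 * j). card (nsets ([S]\<^bsup>2\<^esup>) (j\<^sup>2)))"
      unfolding I2_def using finS by (intro card_SigmaI) (auto simp: finite_imp_finite_nsets)
    also have "\<dots> = (\<Sum>S\<in>nsets {..<n} (2 * j). (2 * j choose 2) choose j\<^sup>2)"
      by (intro sum.cong) (auto simp: nsets_def[of _ "2 * j"])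
    also have "\<dots> = (n choose (2 * j)) * ((2 * j choose 2) choose j\<^sup>2)" by simp
    also have "\<dots> \<le> n ^ (2 * j) * 2 ^ (2 * j choose 2)"
    proof (intro mult_mono)
      show "n choose (2 * j) \<le> n ^ (2 * j)"
        by (metis binomial_eq_0 binomial_le_pow le_0_eq linorder_not_le nat_le_linear)
    qed (auto intro: binomial_le_pow2)
    \<comment> \<open>\<open>2 * j choose 2\<close> equals \<open>j * (2 * j - 1)\<close>; the
      resulting power of 2 is the \<open>4 ^ j\<^sup>2\<close> that merges with the power of
      \<open>q\<close>.\<close>
    also have "\<dots> \<le> n ^ (2 * j) * 2 ^ (2 * j\<^sup>2)"
      by (intro mult_left_mono power_increasing) (auto simp: choose_two power2_eq_square algebra_simps)
    finally have "real (card I2) \<le> real (n ^ (2 * j) * 2 ^ (2 * j\<^sup>2))" by (rule of_nat_mono)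
    then show ?thesis by (simp add: power_mult)
  qed
  have A1: "A1 i \<in> events \<and> prob (A1 i) \<le> p ^ j" if i: "i \<in> I1" for i
  proof -
    obtain v J where vJ: "i = (v, J)" "finite J" "card J = j" "v \<notin> J"
      using i by (auto simp: I1_def nsets_def)
    have "A1 i \<in> events" unfolding A1_def vJ split using vJ(2) by measurable
    with prob_all_near[OF p vJ(2,4)] vJ show ?thesis by (simp add: A1_def)
  qed
  have A2: "A2 i \<in> events \<and> prob (A2 i) \<le> q n ^ j\<^sup>2" if i: "i \<in> I2" for i
  proof -
    obtain S F where SF: "i = (S, F)" by (cases i)
    note F = F_sub[OF i[unfolded SF]]
    have "{\<omega>\<in>space M. \<forall>e\<in>F. ins n e \<omega>} \<in> events"
      using F by (intro sets.sets_Collect_finite_All) (auto simp: subset_iff)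
    then show ?thesis using prob_all_ins[OF F(1)] F by (simp add: A2_def SF)
  qed
  have "prob {\<omega>\<in>space M. real (2 * j) \<le> \<xi> n \<omega>} \<le> prob ((\<Union>i\<in>I1. A1 i) \<union> (\<Union>i\<in>I2. A2 i))"
  proof (rule finite_measure_mono_AE)
    show "AE \<omega> in M. \<omega> \<in> {\<omega>\<in>space M. real (2 * j) \<le> \<xi> n \<omega>} \<longrightarrow> \<omega> \<in> (\<Union>i\<in>I1. A1 i) \<union> (\<Union>i\<in>I2. A2 i)"
    proof (intro AE_I2 impI)
      fix \<omega> assume \<omega>: "\<omega> \<in> space M" "\<omega> \<in> {\<omega>\<in>space M. real (2 * j) \<le> \<xi> n \<omega>}"
      then have "2 * j \<le> clique_number {..<n} (noisy_edges n \<omega>)"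
        unfolding noisy_clique_number_def by simp
      then obtain S where S: "S \<subseteq> {..<n}" "card S = 2 * j" "clique S (noisy_edges n \<omega>)"
        by (subst (asm) clique_number_ge_iff) auto
      have finS: "finite S" using S finite_subset by blast
      from perturbed_clique_dichotomy[OF N S(3,1,2)]
      show "\<omega> \<in> (\<Union>i\<in>I1. A1 i) \<union> (\<Union>i\<in>I2. A2 i)"
      proof (elim disjE bexE exE conjE)
        fix v J assume v: "v \<in> S" and J: "J \<subseteq> S - {v}" "card J = j"
          and near: "\<forall>u\<in>J. N (X u \<omega> - X v \<omega>) \<le> r n"
        have "finite J" using finS J finite_subset by blast
        then have "(v, J) \<in> I1" using v J S by (auto simp: I1_def nsets_def)
        moreover have "\<omega> \<in> A1 (v, J)" using \<omega> near by (simp add: A1_def)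
        ultimately show ?thesis by blast
      next
        fix F assume F: "F \<subseteq> [S]\<^bsup>2\<^esup>" "card F = j\<^sup>2" "\<forall>e\<in>F. ins n e \<omega>"
        have "finite F" using finS F finite_subset finite_imp_finite_nsets by blast
        then have "(S, F) \<in> I2" using F S finS by (auto simp: I2_def nsets_def)
        moreover have "\<omega> \<in> A2 (S, F)" using \<omega> F by (simp add: A2_def)
        ultimately show ?thesis by blast
      qed
    qed
    show "(\<Union>i\<in>I1. A1 i) \<union> (\<Union>i\<in>I2. A2 i) \<in> events"
      using A1 A2 fin1 fin2 by (intro sets.Un sets.finite_UN) auto
  qed
  also have "\<dots> \<le> prob (\<Union>i\<in>I1. A1 i) + prob (\<Union>i\<in>I2. A2 i)"
    using A1 A2 fin1 fin2 by (intro measure_Un_le sets.finite_UN) auto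
  also have "\<dots> \<le> (\<Sum>i\<in>I1. prob (A1 i)) + (\<Sum>i\<in>I2. prob (A2 i))"
    using A1 A2 fin1 fin2 by (intro add_mono finite_measure_subadditive_finite) auto
  also have "\<dots> \<le> (\<Sum>i\<in>I1. p ^ j) + (\<Sum>i\<in>I2. q n ^ j\<^sup>2)"
    using A1 A2 by (intro add_mono sum_mono) auto
  also have "\<dots> = real (card I1) * p ^ j + real (card I2) * q n ^ j\<^sup>2" by simp
  also have "\<dots> \<le> real (n * (n choose j)) * p ^ j + real n ^ (2 * j) * 4 ^ j\<^sup>2 * q n ^ j\<^sup>2"
    using card1 card2 p0 q[of n] by (intro add_mono mult_right_mono of_nat_mono) auto
  finally show ?thesis by (simp add: power_mult_distrib mult.assoc)
qed

text \<open>Without deletions either reason suffices: a close pair stays an edge whatever its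
  insertion coin shows, and a distant pair becomes one when its coin succeeds.\<close>

lemma card_le_noisy_clique_number:
  assumes S: "S \<subseteq> {..<n}" and nodel: "\<forall>e\<in>[{..<n}]\<^bsup>2\<^esup>. \<not> del n e \<omega>"
    and adj: "\<And>u v. u \<in> S \<Longrightarrow> v \<in> S \<Longrightarrow> u \<noteq> v \<Longrightarrow> ins n {u, v} \<omega> \<or> N (X u \<omega> - X v \<omega>) \<le> r n"
  shows "real (card S) \<le> \<xi> n \<omega>"
proof -
  have "clique S (noisy_edges n \<omega>)"
    unfolding clique_def
  proof (intro ballI impI)
    fix u v assume uv: "u \<in> S" "v \<in> S" "u \<noteq> v"
    with S have "{u, v} \<in> [{..<n}]\<^bsup>2\<^esup>" "u < n" "v < n" by auto
    with nodel adj[OF uv] uv show "{u, v} \<in> noisy_edges n \<omega>"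
      by (auto simp: perturb_def rgg_edges_def)
  qed
  from card_le_clique_number[OF _ S this] show ?thesis by (simp add: noisy_clique_number_def)
qed

text \<open>The union bound runs over the sets with fewer than \<open>k\<close> vertices: if each of them has a common
  neighbour through inserted pairs, then cliques can be grown greedily up to size \<open>k\<close>.\<close>

lemma prob_clique_number_less_inserted:
  assumes k: "1 \<le> k" "k \<le> n"
  shows "prob {\<omega>\<in>space M. \<xi> n \<omega> < real k} \<le> real n ^ k * (1 - q n ^ (k - 1)) ^ (n - k)"
proof -
  define I where "I = {S. S \<subseteq> {..<n} \<and> card S < k}"
  \<comment> \<open>The bad event for \<open>S\<close>: no outside vertex is joined to all of
    \<open>S\<close> by inserted pairs.\<close>
  define A where "A S = {\<omega>\<in>space M. \<forall>v\<in>{..<n} - S. \<exists>u\<in>S. \<not> ins n {u, v} \<omega>}" for S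
  have finI: "finite I" by (simp add: I_def)
  have card_I: "card I \<le> n ^ k"
  proof -
    have "I = (\<Union>i<k. nsets {..<n} i)"
      by (auto simp: I_def nsets_def intro: finite_subset)
    then have "card I \<le> (\<Sum>i<k. card (nsets {..<n} i))" by (simp only: card_UN_le finite_lessThan)
    also have "\<dots> \<le> (\<Sum>i<k. n ^ (k - 1))"
    proof (rule sum_mono)
      fix i assume "i \<in> {..<k}"
      then have "i \<le> n" "n ^ i \<le> n ^ (k - 1)" using k by (auto intro: power_increasing)
      then show "card (nsets {..<n} i) \<le> n ^ (k - 1)"
        using binomial_le_pow[of i n] by simp
    qed
    also have "\<dots> = k * n ^ (k - 1)" by simp
    also have "\<dots> \<le> n * n ^ (k - 1)" using k by (intro mult_right_mono) auto
    also have "\<dots> = n ^ k" using k by (metis Suc_diff_le diff_Suc_1 power_Suc One_nat_def)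
    finally show ?thesis .
  qed
  have A: "A S \<in> events \<and> prob (A S) \<le> (1 - q n ^ (k - 1)) ^ (n - k)" if S_in: "S \<in> I" for S
  proof -
    have S: "S \<subseteq> {..<n}" "card S < k" "finite S" using S_in by (auto simp: I_def intro: finite_subset)
    \<comment> \<open>The coins between \<open>v\<close> and \<open>S\<close>. For different
      \<open>v\<close> outside \<open>S\<close> these blocks are disjoint, so the failures of the
      candidates are independent.\<close>
    define K where "K v = (\<lambda>u. {u, v}) ` S" for v
    define P where "P v x = (\<exists>e\<in>K v. \<not> x e)" for v and x :: "nat set \<Rightarrow> bool"
    have K: "K v \<subseteq> [{..<n}]\<^bsup>2\<^esup>" if "v \<in> {..<n} - S" for v
      using that S by (auto simp: K_def)
    have disj: "disjoint_family_on K ({..<n} - S)"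
      by (auto simp: disjoint_family_on_def K_def doubleton_eq_iff)
    have finK: "finite (K v)" for v using S by (simp add: K_def)
    have cardK: "card (K v) = card S" for v
      unfolding K_def by (intro card_image) (auto simp: inj_on_def doubleton_eq_iff)
    have A_eq: "A S = {\<omega>\<in>space M. \<forall>v\<in>{..<n} - S. P v (\<lambda>e\<in>K v. ins n e \<omega>)}"
      by (auto simp: A_def P_def K_def)
    have ev: "{\<omega>\<in>space M. P v (\<lambda>e\<in>K v. ins n e \<omega>)} \<in> events \<and>
        prob {\<omega>\<in>space M. P v (\<lambda>e\<in>K v. ins n e \<omega>)} = 1 - q n ^ card S" if v: "v \<in> {..<n} - S" for v
    proof -
      have ev: "{\<omega>\<in>space M. \<forall>e\<in>K v. ins n e \<omega>} \<in> events"
        using K[OF v] finK by (intro sets.sets_Collect_finite_All) (auto simp: subset_iff)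
      have eq: "{\<omega>\<in>space M. P v (\<lambda>e\<in>K v. ins n e \<omega>)} = space M - {\<omega>\<in>space M. \<forall>e\<in>K v. ins n e \<omega>}"
        by (auto simp: P_def)
      show ?thesis using prob_compl[OF ev] ev prob_all_ins[OF K[OF v]] unfolding eq by (simp add: cardK)
    qed
    have "prob (A S) = (\<Prod>v\<in>{..<n} - S. prob {\<omega>\<in>space M. P v (\<lambda>e\<in>K v. ins n e \<omega>)})"
      unfolding A_eq
    proof (rule prob_indep_blocks[OF ins_indep])
      fix v
      show "{x\<in>space (PiM (K v) (\<lambda>_. count_space UNIV)). P v x} \<in> sets (PiM (K v) (\<lambda>_. count_space UNIV))"
        unfolding P_def using finK by measurable
    qed (use K disj in auto)
    also have "\<dots> = (1 - q n ^ card S) ^ (n - card S)"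
      using ev S by (simp add: card_Diff_subset)
    \<comment> \<open>The largest sets are the worst case: each candidate then needs
      \<open>k - 1\<close> insertions, and at least \<open>n - k\<close> candidates always
      remain.\<close>
    also have "\<dots> \<le> (1 - q n ^ (k - 1)) ^ (n - card S)"
      using S q[of n] by (intro power_mono diff_left_mono power_decreasing) (auto simp: power_le_one)
    also have "\<dots> \<le> (1 - q n ^ (k - 1)) ^ (n - k)"
      using S q[of n] by (intro power_decreasing) (auto simp: power_le_one)
    finally have "prob (A S) \<le> (1 - q n ^ (k - 1)) ^ (n - k)" .
    moreover have "A S \<in> events"
      unfolding A_eq using ev by (intro sets.sets_Collect_finite_All) auto
    ultimately show ?thesis by simp
  qed
  have "prob {\<omega>\<in>space M. \<xi> n \<omega> < real k} \<le> prob (\<Union>S\<in>I. A S)"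
  proof (rule finite_measure_mono_AE)
    show "AE \<omega> in M. \<omega> \<in> {\<omega>\<in>space M. \<xi> n \<omega> < real k} \<longrightarrow> \<omega> \<in> (\<Union>S\<in>I. A S)"
      using AE_no_del[of n]
    proof eventually_elim
      case (elim \<omega>)
      have "real k \<le> \<xi> n \<omega>" if \<omega>: "\<omega> \<in> space M" and no: "\<omega> \<notin> (\<Union>S\<in>I. A S)"
      proof -
        \<comment> \<open>Greedy growth: a set built so far with fewer than \<open>k\<close>
          vertices lies in \<open>I\<close>, so outside its bad event it can be extended.\<close>
        have "\<exists>S\<subseteq>{..<n}. card S = i \<and> (\<forall>u\<in>S. \<forall>v\<in>S. u \<noteq> v \<longrightarrow> ins n {u, v} \<omega>)" if "i \<le> k" for i
          using that
        proof (induction i)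
          case 0
          show ?case by (intro exI[of _ "{}"]) auto
        next
          case (Suc i)
          then obtain S where S: "S \<subseteq> {..<n}" "card S = i" "\<forall>u\<in>S. \<forall>v\<in>S. u \<noteq> v \<longrightarrow> ins n {u, v} \<omega>"
            by auto
          have finS: "finite S" using S finite_subset by blast
          have "S \<in> I" using S Suc.prems by (auto simp: I_def)
          then have "\<omega> \<notin> A S" using no by blast
          then obtain v where v: "v \<in> {..<n} - S" "\<forall>u\<in>S. ins n {u, v} \<omega>"
            using \<omega> by (auto simp: A_def)
          then have "card (insert v S) = Suc i" using S finS by simp
          moreover have "\<forall>u\<in>insert v S. \<forall>w\<in>insert v S. u \<noteq> w \<longrightarrow> ins n {u, w} \<omega>"
            using S v by (auto simp: insert_commute)
          ultimately show ?case using S v by (intro exI[of _ "insert v S"]) auto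
        qed
        from this[of k] obtain S where S: "S \<subseteq> {..<n}" "card S = k"
          "\<forall>u\<in>S. \<forall>v\<in>S. u \<noteq> v \<longrightarrow> ins n {u, v} \<omega>" by auto
        show ?thesis using card_le_noisy_clique_number[OF S(1) elim] S by auto
      qed
      then show ?case by fastforce
    qed
    show "(\<Union>S\<in>I. A S) \<in> events" using A finI by (intro sets.finite_UN) auto
  qed
  also have "\<dots> \<le> (\<Sum>S\<in>I. prob (A S))"
    using A finI by (intro finite_measure_subadditive_finite) auto
  also have "\<dots> \<le> (\<Sum>S\<in>I. (1 - q n ^ (k - 1)) ^ (n - k))" using A by (intro sum_mono) auto
  also have "\<dots> = real (card I) * (1 - q n ^ (k - 1)) ^ (n - k)" by simp
  also have "\<dots> \<le> real (n ^ k) * (1 - q n ^ (k - 1)) ^ (n - k)"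
    using card_I q[of n] by (intro mult_right_mono of_nat_mono) (auto simp: power_le_one)
  finally show ?thesis by simp
qed

section \<open>Lower tail from points that share a grid cell\<close>

lemma prob_miss:
  assumes A: "A \<in> sets borel" and G: "finite G"
  shows "prob {\<omega>\<in>space M. \<forall>i\<in>G. X i \<omega> \<notin> A} = (1 - measure \<nu> A) ^ card G"
proof -
  interpret \<nu>: prob_space \<nu> by (rule bounded_density_prob_space[OF f])
  have "measure \<nu> (- A) = 1 - measure \<nu> A"
    using \<nu>.prob_compl[of A] A by (simp add: bounded_density_sets[OF f] bounded_density_space[OF f] Compl_eq_Diff_UNIV)
  then have *: "prob {\<omega>\<in>space M. X i \<omega> \<in> - A} = 1 - measure \<nu> A" for i
    using A by (subst prob_X) auto
  have "prob {\<omega>\<in>space M. \<forall>i\<in>G. X i \<omega> \<in> - A} = (\<Prod>i\<in>G. prob {\<omega>\<in>space M. X i \<omega> \<in> - A})"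
    by (rule prob_indep_vars_all[OF X_indep _ G]) (use A in auto)
  then show ?thesis unfolding * by simp
qed

lemma miss_sets:
  assumes "A \<in> sets borel" "finite G"
  shows "{\<omega>\<in>space M. \<forall>i\<in>G. X i \<omega> \<notin> A} \<in> events"
  using assms by measurable

lemma hit_eq: "{\<omega>\<in>space M. \<exists>i\<in>G. X i \<omega> \<in> A} = space M - {\<omega>\<in>space M. \<forall>i\<in>G. X i \<omega> \<notin> A}"
  by auto

lemma prob_hit:
  assumes A: "A \<in> sets borel" and G: "finite G"
  shows "prob {\<omega>\<in>space M. \<exists>i\<in>G. X i \<omega> \<in> A} = 1 - (1 - measure \<nu> A) ^ card G"
  unfolding hit_eq using prob_compl[OF miss_sets[OF A G]] prob_miss[OF A G] by simp

text \<open>Disjoint sets compete for the same points. By inclusion-exclusion the claim reduces to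
  missing both, where one point contributes \<open>1 - (a + b)\<close> instead of
  \<open>(1 - a) * (1 - b)\<close>.\<close>

lemma prob_hit_both:
  assumes A: "A \<in> sets borel" and B: "B \<in> sets borel" and AB: "A \<inter> B = {}" and G: "finite G"
  shows "prob {\<omega>\<in>space M. (\<exists>i\<in>G. X i \<omega> \<in> A) \<and> (\<exists>i\<in>G. X i \<omega> \<in> B)} \<le>
    prob {\<omega>\<in>space M. \<exists>i\<in>G. X i \<omega> \<in> A} * prob {\<omega>\<in>space M. \<exists>i\<in>G. X i \<omega> \<in> B}"
proof -
  interpret \<nu>: prob_space \<nu> by (rule bounded_density_prob_space[OF f])
  let ?a = "measure \<nu> A" and ?b = "measure \<nu> B" and ?g = "card G"
  let ?mA = "{\<omega>\<in>space M. \<forall>i\<in>G. X i \<omega> \<notin> A}" and ?mB = "{\<omega>\<in>space M. \<forall>i\<in>G. X i \<omega> \<notin> B}"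
  have Un: "measure \<nu> (A \<union> B) = ?a + ?b"
    using \<nu>.finite_measure_Union[OF _ _ AB] A B by (simp add: bounded_density_sets[OF f])
  have Int: "?mA \<inter> ?mB = {\<omega>\<in>space M. \<forall>i\<in>G. X i \<omega> \<notin> A \<union> B}" by auto
  have pInt: "prob (?mA \<inter> ?mB) = (1 - (?a + ?b)) ^ ?g"
    unfolding Int Un[symmetric] using A B G by (intro prob_miss) auto
  have ev: "?mA \<in> events" "?mB \<in> events" using miss_sets A B G by auto
  have "{\<omega>\<in>space M. (\<exists>i\<in>G. X i \<omega> \<in> A) \<and> (\<exists>i\<in>G. X i \<omega> \<in> B)} = space M - (?mA \<union> ?mB)" by auto
  then have "prob {\<omega>\<in>space M. (\<exists>i\<in>G. X i \<omega> \<in> A) \<and> (\<exists>i\<in>G. X i \<omega> \<in> B)} = 1 - prob (?mA \<union> ?mB)"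
    using prob_compl[of "?mA \<union> ?mB"] ev by simp
  also have "prob (?mA \<union> ?mB) = prob ?mA + prob ?mB - prob (?mA \<inter> ?mB)"
    using ev by (intro measure_Un3) (auto simp: fmeasurable_eq_sets)
  also have "1 - \<dots> = 1 - (1 - ?a) ^ ?g - (1 - ?b) ^ ?g + (1 - (?a + ?b)) ^ ?g"
    unfolding pInt using prob_miss A B G by simp
  also have "(1 - (?a + ?b)) ^ ?g \<le> ((1 - ?a) * (1 - ?b)) ^ ?g"
  proof (intro power_mono)
    show "0 \<le> 1 - (?a + ?b)" using \<nu>.prob_le_1[of "A \<union> B"] Un by simp
    show "1 - (?a + ?b) \<le> (1 - ?a) * (1 - ?b)" by (simp add: algebra_simps)
  qed
  finally show ?thesis
    unfolding prob_hit[OF A G] prob_hit[OF B G] power_mult_distrib by (simp add: algebra_simps)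
qed

text \<open>Splitting the first \<open>k * g\<close> points into \<open>k\<close> groups, a cell hit by all groups
  yields a clique of size \<open>k\<close>. For disjoint cells these events are negatively correlated, so
  that no Poissonization is needed for the second moment method.\<close>

lemma prob_clique_number_less_cells:
  assumes \<Q>: "finite \<Q>" "disjoint \<Q>" "\<Q> \<subseteq> sets borel"
    and mass: "\<And>Q. Q \<in> \<Q> \<Longrightarrow> a \<le> measure \<nu> Q" and a: "0 \<le> a" "a \<le> 1"
    and diam: "\<And>Q x y. Q \<in> \<Q> \<Longrightarrow> x \<in> Q \<Longrightarrow> y \<in> Q \<Longrightarrow> N (x - y) \<le> r n"
    and kg: "k * g \<le> n"
  shows "prob {\<omega>\<in>space M. \<xi> n \<omega> < real k} * (real (card \<Q>) * (1 - (1 - a) ^ g) ^ k) \<le> 1"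
proof -
  interpret \<nu>: prob_space \<nu> by (rule bounded_density_prob_space[OF f])
  \<comment> \<open>Consecutive blocks of \<open>g\<close> indices; the block of an index
    \<open>x\<close> is recovered as \<open>x div g\<close>.\<close>
  define G where "G j = {j * g..<Suc j * g}" for j
  have finG: "finite (G j)" and cardG: "card (G j) = g" for j by (simp_all add: G_def)
  have G_unique: "i = j" if "x \<in> G i" "x \<in> G j" for x i j
  proof -
    have *: "x div g = j" if "x \<in> G j" for j
      using that by (intro div_nat_eqI) (auto simp: G_def mult.commute)
    show ?thesis using *[OF that(1)] *[OF that(2)] by simp
  qed
  have G_disj: "disjoint_family_on G {..<k}"
    using G_unique by (auto simp: disjoint_family_on_def)
  have G_less: "x < n" if "x \<in> G j" "j < k" for x j
  proof -
    have "x < Suc j * g" using that by (simp add: G_def)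
    also have "\<dots> \<le> k * g" using that by (intro mult_right_mono) auto
    finally show ?thesis using kg by simp
  qed
  define E where "E Q = {\<omega>\<in>space M. \<forall>j\<in>{..<k}. \<exists>i\<in>G j. X i \<omega> \<in> Q}" for Q
  have Q_sets: "Q \<in> sets borel" if "Q \<in> \<Q>" for Q using that \<Q> by blast
  have E_sets: "E Q \<in> events" if Q: "Q \<in> \<Q>" for Q
  proof -
    note [measurable] = Q_sets[OF Q]
    show ?thesis unfolding E_def using finG by measurable
  qed
  have blocks: "prob {\<omega>\<in>space M. \<forall>j\<in>{..<k}. P (\<lambda>i\<in>G j. X i \<omega>) j} =
      (\<Prod>j<k. prob {\<omega>\<in>space M. P (\<lambda>i\<in>G j. X i \<omega>) j})"
    if "\<And>j. {x\<in>space (PiM (G j) (\<lambda>_. borel)). P x j} \<in> sets (PiM (G j) (\<lambda>_. borel))" for P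
    using prob_indep_blocks[OF X_indep, of "{..<k}" G "\<lambda>j x. P x j"] G_disj that by auto
  have E_prob: "prob (E Q) = (\<Prod>j<k. prob {\<omega>\<in>space M. \<exists>i\<in>G j. X i \<omega> \<in> Q})" if Q: "Q \<in> \<Q>" for Q
  proof -
    note [measurable] = Q_sets[OF Q]
    have "{x\<in>space (PiM (G j) (\<lambda>_. borel)). \<exists>i\<in>G j. x i \<in> Q} \<in> sets (PiM (G j) (\<lambda>_. borel))" for j
      using finG by measurable
    from blocks[of "\<lambda>x j. \<exists>i\<in>G j. x i \<in> Q", OF this] show ?thesis by (simp add: E_def)
  qed
  have "prob (space M - (\<Union>Q\<in>\<Q>. E Q)) * (\<Sum>Q\<in>\<Q>. prob (E Q)) \<le> 1"
  proof (rule neg_correlated_second_moment[OF \<Q>(1) E_sets])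
    fix Q R assume QR: "Q \<in> \<Q>" "R \<in> \<Q>" "Q \<noteq> R"
    then have dj: "Q \<inter> R = {}" using \<Q> by (auto simp: disjoint_def)
    note [measurable] = Q_sets[OF QR(1)] Q_sets[OF QR(2)]
    have meas: "{x\<in>space (PiM (G j) (\<lambda>_. borel)). (\<exists>i\<in>G j. x i \<in> Q) \<and> (\<exists>i\<in>G j. x i \<in> R)} \<in> sets (PiM (G j) (\<lambda>_. borel))" for j
      using finG by measurable
    have "E Q \<inter> E R = {\<omega>\<in>space M. \<forall>j\<in>{..<k}. (\<exists>i\<in>G j. X i \<omega> \<in> Q) \<and> (\<exists>i\<in>G j. X i \<omega> \<in> R)}"
      by (auto simp: E_def)
    then have "prob (E Q \<inter> E R) = (\<Prod>j<k. prob {\<omega>\<in>space M. (\<exists>i\<in>G j. X i \<omega> \<in> Q) \<and> (\<exists>i\<in>G j. X i \<omega> \<in> R)})"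
      using blocks[of "\<lambda>x j. (\<exists>i\<in>G j. x i \<in> Q) \<and> (\<exists>i\<in>G j. x i \<in> R)", OF meas] by simp
    \<comment> \<open>The groups are independent, so the negative correlation within each group
      multiplies up.\<close>
    also have "\<dots> \<le> (\<Prod>j<k. prob {\<omega>\<in>space M. \<exists>i\<in>G j. X i \<omega> \<in> Q} * prob {\<omega>\<in>space M. \<exists>i\<in>G j. X i \<omega> \<in> R})"
      by (intro prod_mono conjI prob_hit_both dj finG Q_sets QR) auto
    also have "\<dots> = prob (E Q) * prob (E R)"
      using QR by (simp add: E_prob prod.distrib)
    finally show "prob (E Q \<inter> E R) \<le> prob (E Q) * prob (E R)" .
  qed
  moreover have "prob {\<omega>\<in>space M. \<xi> n \<omega> < real k} \<le> prob (space M - (\<Union>Q\<in>\<Q>. E Q))"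
  proof (rule finite_measure_mono_AE)
    show "AE \<omega> in M. \<omega> \<in> {\<omega>\<in>space M. \<xi> n \<omega> < real k} \<longrightarrow> \<omega> \<in> space M - (\<Union>Q\<in>\<Q>. E Q)"
      using AE_no_del[of n]
    proof eventually_elim
      case (elim \<omega>)
      have "real k \<le> \<xi> n \<omega>" if Q: "Q \<in> \<Q>" "\<omega> \<in> E Q" for Q
      proof -
        have "\<forall>j\<in>{..<k}. \<exists>i\<in>G j. X i \<omega> \<in> Q" using Q by (simp add: E_def)
        then obtain v where v: "\<And>j. j < k \<Longrightarrow> v j \<in> G j \<and> X (v j) \<omega> \<in> Q"
          by (metis lessThan_iff)
        \<comment> \<open>The representatives are distinct because they come from disjoint groups,
          so the clique really has \<open>k\<close> vertices.\<close>
        have inj: "inj_on v {..<k}"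
        proof (rule inj_onI)
          fix i j assume "i \<in> {..<k}" "j \<in> {..<k}" "v i = v j"
          then show "i = j" using G_unique[of "v i" i j] v[of i] v[of j] by simp
        qed
        have "real (card (v ` {..<k})) \<le> \<xi> n \<omega>"
        proof (rule card_le_noisy_clique_number[OF _ elim])
          show "v ` {..<k} \<subseteq> {..<n}" using v G_less by blast
          fix u w assume "u \<in> v ` {..<k}" "w \<in> v ` {..<k}"
          then have "X u \<omega> \<in> Q" "X w \<omega> \<in> Q" using v by auto
          then show "ins n {u, w} \<omega> \<or> N (X u \<omega> - X w \<omega>) \<le> r n" using diam Q by blast
        qed
        with inj show ?thesis by (simp add: card_image)
      qed
      then show ?case by fastforce
    qed
    show "space M - (\<Union>Q\<in>\<Q>. E Q) \<in> events"
      using E_sets \<Q>(1) by (intro sets.Diff sets.top sets.finite_UN) auto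
  qed
  moreover have "real (card \<Q>) * (1 - (1 - a) ^ g) ^ k \<le> (\<Sum>Q\<in>\<Q>. prob (E Q))"
  proof -
    have "(1 - (1 - a) ^ g) ^ k \<le> prob (E Q)" if Q: "Q \<in> \<Q>" for Q
    proof -
      have "(1 - a) ^ g \<le> 1" using a by (intro power_le_one) auto
      moreover have "(1 - measure \<nu> Q) ^ g \<le> (1 - a) ^ g"
        using mass[OF Q] \<nu>.prob_le_1[of Q] by (intro power_mono) auto
      ultimately have "(1 - (1 - a) ^ g) ^ k \<le> (1 - (1 - measure \<nu> Q) ^ g) ^ k"
        by (intro power_mono) linarith+
      then show ?thesis by (simp add: E_prob[OF Q] prob_hit[OF Q_sets[OF Q] finG] cardG)
    qed
    then show ?thesis using sum_bounded_below[of \<Q> "(1 - (1 - a) ^ g) ^ k" "\<lambda>Q. prob (E Q)"] by simp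
  qed
  moreover have "0 \<le> (1 - (1 - a) ^ g) ^ k"
    using a power_le_one[of "1 - a" g] by (intro zero_le_power) auto
  ultimately show ?thesis
    by (elim order_trans[rotated]) (intro mult_mono, auto)
qed

end

section \<open>Asymptotics\<close>

lemma power_le_exp:
  assumes "0 \<le> x" "x \<le> exp (- y)"
  shows "x ^ j \<le> exp (- (real j * y))"
  using power_mono[OF assms(2,1), of j] by (simp add: exp_of_nat_mult[symmetric])

text \<open>A weak Stirling bound: one term of the exponential series at \<open>j\<close> is at most
  the whole sum.\<close>

lemma self_power_le_exp_fact: "real j ^ j \<le> exp (real j) * fact j"
proof -
  have "(\<Sum>i\<in>{j}. real j ^ i /\<^sub>R fact i) \<le> (\<Sum>i. real j ^ i /\<^sub>R fact i)"
    by (intro sum_le_suminf summable_exp_generic) auto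
  then have "real j ^ j / fact j \<le> exp (real j)" by (simp add: exp_def field_simps)
  then show ?thesis by (simp add: field_simps)
qed

text \<open>The familiar bound of \<open>n choose j\<close> by \<open>(e * n / j) ^ j\<close>. The
  division by \<open>j\<close> is what makes a growing \<open>j\<close> effective when
  \<open>n * p\<close> does not vanish.\<close>

lemma choose_mult_power_le:
  assumes "0 \<le> p"
  shows "real (n choose j) * p ^ j \<le> (exp 1 * (real n * p) / real j) ^ j"
proof (cases "j = 0")
  case False
  have "real (n choose j) * real j ^ j \<le> real (n choose j) * (exp (real j) * fact j)"
    by (intro mult_left_mono self_power_le_exp_fact) auto
  also have "\<dots> = exp (real j) * real ((n choose j) * fact j)" by simp
  also have "\<dots> \<le> exp (real j) * real (n ^ j)"
    by (intro mult_left_mono of_nat_mono binomial_fact_pow) auto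
  finally have "real (n choose j) \<le> (exp 1 * real n / real j) ^ j"
    using False by (simp add: power_divide power_mult_distrib field_simps exp_of_nat_mult[symmetric])
  then have "real (n choose j) * p ^ j \<le> (exp 1 * real n / real j) ^ j * p ^ j"
    using assms by (intro mult_right_mono) auto
  moreover have "exp 1 * (real n * p) / real j = exp 1 * real n / real j * p" by simp
  ultimately show ?thesis by (simp only: power_mult_distrib)
qed simp

text \<open>The common last step of the conditions \<open>near\<close> and \<open>far\<close> below:
  only exponents remain to be compared.\<close>

lemma power_mult_power_le_1:
  assumes "0 \<le> x" "x \<le> exp (- y)" "1 \<le> n" "real m * ln (real n) \<le> real j * y"
  shows "real n ^ m * x ^ j \<le> 1"
proof -
  have "real n ^ m * x ^ j \<le> exp (real m * ln (real n)) * exp (- (real j * y))"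
    using assms power_le_exp[OF assms(1,2)] by (intro mult_mono) (auto simp: exp_of_nat_mult)
  also have "\<dots> \<le> 1" using assms(4) by (simp add: exp_add[symmetric])
  finally show ?thesis .
qed

section \<open>From tail estimates to orders of growth\<close>

context noisy_rgg begin

lemma as_lesssimI:
  assumes lim: "(\<lambda>n. prob {\<omega>\<in>space M. k n \<le> \<xi> n \<omega>}) \<longlonglongrightarrow> 0"
    and C: "C > 0" "\<forall>\<^sub>F n in sequentially. k n \<le> C * K n"
  shows "as_lesssim M \<xi> K"
  unfolding as_lesssim_def
proof (intro exI conjI)
  show "(\<lambda>n. prob {\<omega>\<in>space M. \<xi> n \<omega> \<le> C * K n}) \<longlonglongrightarrow> 1"
  proof (rule tendsto_sandwich[of "\<lambda>n. 1 - prob {\<omega>\<in>space M. k n \<le> \<xi> n \<omega>}" _ _ "\<lambda>_. 1"])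
    show "\<forall>\<^sub>F n in sequentially. 1 - prob {\<omega>\<in>space M. k n \<le> \<xi> n \<omega>} \<le> prob {\<omega>\<in>space M. \<xi> n \<omega> \<le> C * K n}"
      using C(2)
    proof eventually_elim
      case (elim n)
      have "1 - prob {\<omega>\<in>space M. k n \<le> \<xi> n \<omega>} = prob (space M - {\<omega>\<in>space M. k n \<le> \<xi> n \<omega>})"
        by (subst prob_compl) auto
      also have "\<dots> \<le> prob {\<omega>\<in>space M. \<xi> n \<omega> \<le> C * K n}"
        using elim by (intro finite_measure_mono) auto
      finally show ?case .
    qed
    show "(\<lambda>n. 1 - prob {\<omega>\<in>space M. k n \<le> \<xi> n \<omega>}) \<longlonglongrightarrow> 1" using tendsto_diff[OF tendsto_const lim, of 1] by simp
  qed auto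
qed fact

lemma as_gtrsimI:
  assumes lim: "(\<lambda>n. prob {\<omega>\<in>space M. \<xi> n \<omega> < k n}) \<longlonglongrightarrow> 0"
    and c: "c > 0" "\<forall>\<^sub>F n in sequentially. c * K n \<le> k n"
  shows "as_gtrsim M \<xi> K"
  unfolding as_gtrsim_def
proof (intro exI conjI)
  show "(\<lambda>n. prob {\<omega>\<in>space M. c * K n \<le> \<xi> n \<omega>}) \<longlonglongrightarrow> 1"
  proof (rule tendsto_sandwich[of "\<lambda>n. 1 - prob {\<omega>\<in>space M. \<xi> n \<omega> < k n}" _ _ "\<lambda>_. 1"])
    show "\<forall>\<^sub>F n in sequentially. 1 - prob {\<omega>\<in>space M. \<xi> n \<omega> < k n} \<le> prob {\<omega>\<in>space M. c * K n \<le> \<xi> n \<omega>}"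
      using c(2)
    proof eventually_elim
      case (elim n)
      have "1 - prob {\<omega>\<in>space M. \<xi> n \<omega> < k n} = prob (space M - {\<omega>\<in>space M. \<xi> n \<omega> < k n})"
        by (subst prob_compl) auto
      also have "\<dots> \<le> prob {\<omega>\<in>space M. c * K n \<le> \<xi> n \<omega>}"
        using elim by (intro finite_measure_mono) auto
      finally show ?case .
    qed
    show "(\<lambda>n. 1 - prob {\<omega>\<in>space M. \<xi> n \<omega> < k n}) \<longlonglongrightarrow> 1" using tendsto_diff[OF tendsto_const lim, of 1] by simp
  qed auto
qed fact

lemma as_gtrsim_one: "as_gtrsim M \<xi> (\<lambda>_. 1)"
proof (rule as_gtrsimI[of "\<lambda>_. 1" 1])
  have "prob {\<omega>\<in>space M. \<xi> n \<omega> < 1} = 0" if n: "n > 0" for n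
  proof -
    have "AE \<omega> in M. \<not> \<xi> n \<omega> < 1"
      using AE_no_del[of n]
    proof eventually_elim
      case (elim \<omega>)
      show ?case using card_le_noisy_clique_number[of "{0}", OF _ elim] n by auto
    qed
    then have "prob {\<omega>\<in>space M. \<xi> n \<omega> < 1} = prob {}"
      by (intro finite_measure_eq_AE) auto
    then show ?thesis by simp
  qed
  then show "(\<lambda>n. prob {\<omega>\<in>space M. \<xi> n \<omega> < 1}) \<longlonglongrightarrow> 0"
    by (intro tendsto_eventually eventually_sequentiallyI[of 1]) auto
qed auto

text \<open>The exponents 2 and 3 leave a margin of \<open>1 / n\<close> in each half of the failure
  probability: the first half is \<open>n\<close> times a quantity at most \<open>1 / n^2\<close>,
  the second is at most \<open>(1 / n) ^ j\<close> with \<open>j \<ge> 1\<close>. An upper bound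
  thus amounts to choosing \<open>j\<close>.\<close>

lemma as_lesssim_of_bounds:
  assumes A: "A > 0" "\<And>x s. s > 0 \<Longrightarrow> measure \<nu> {y. N (y - x) \<le> s} \<le> A * s ^ DIM('a)"
    and r: "\<And>n. 0 < r n"
    and j: "\<forall>\<^sub>F n in sequentially. 1 \<le> j n"
    and near: "\<forall>\<^sub>F n in sequentially.
      (real n)\<^sup>2 * (exp 1 * A * (real n * r n ^ DIM('a)) / real (j n)) ^ j n \<le> 1"
    and far: "\<forall>\<^sub>F n in sequentially. real n ^ 3 * (4 * q n) ^ j n \<le> 1"
    and C: "C > 0" "\<forall>\<^sub>F n in sequentially. real (j n) \<le> C * K n"
  shows "as_lesssim M \<xi> K"
proof (rule as_lesssimI[of "\<lambda>n. real (2 * j n)" "2 * C"])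
  show "(\<lambda>n. prob {\<omega>\<in>space M. real (2 * j n) \<le> \<xi> n \<omega>}) \<longlonglongrightarrow> 0"
  proof (rule tendsto_sandwich[of "\<lambda>_. 0" _ _ "\<lambda>n. 2 / real n"])
    show "\<forall>\<^sub>F n in sequentially. prob {\<omega>\<in>space M. real (2 * j n) \<le> \<xi> n \<omega>} \<le> 2 / real n"
      using j near far eventually_gt_at_top[of 0]
    proof eventually_elim
      case (elim n)
      let ?p = "A * r n ^ DIM('a)"
      have "real n * (real (n choose j n) * ?p ^ j n) \<le> real n * (exp 1 * (real n * ?p) / real (j n)) ^ j n"
        using A r[of n] by (intro mult_left_mono choose_mult_power_le) auto
      also have "\<dots> \<le> 1 / real n" using elim by (simp add: field_simps power2_eq_square)
      finally have 1: "real n * real (n choose j n) * ?p ^ j n \<le> 1 / real n" by (simp add: mult.assoc)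
      have "real n ^ (2 * j n) * (4 * q n) ^ (j n)\<^sup>2 = ((real n)\<^sup>2 * (4 * q n) ^ j n) ^ j n"
        by (simp only: power_mult_distrib power_mult[symmetric] power2_eq_square[of "j n"])
      also have "\<dots> \<le> (1 / real n) ^ j n"
        using elim q[of n] by (intro power_mono) (auto simp: field_simps power2_eq_square power3_eq_cube)
      also have "\<dots> \<le> (1 / real n) ^ 1"
        using elim by (intro power_decreasing) auto
      finally show ?case
        using prob_clique_number_ge[of n ?p "j n"] A r[of n] 1 by simp
    qed
    show "(\<lambda>n. 2 / real n) \<longlonglongrightarrow> 0" by real_asymp
  qed auto
  show "\<forall>\<^sub>F n in sequentially. real (2 * j n) \<le> 2 * C * K n" using C(2) by eventually_elim simp
qed (use C in simp)

text \<open>With \<open>k\<close> near half of \<open>log_{1/q} n\<close>, a candidate is joined to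
  \<open>k - 1\<close> vertices with probability at least \<open>n^(-1/2)\<close>. At least
  \<open>n / 2\<close> candidates all fail with probability at most
  \<open>exp (- sqrt n / 2)\<close>, which beats the at most \<open>exp ((ln n)^2)\<close> sets in
  the union bound.\<close>

lemma as_gtrsim_inserted:
  assumes q': "\<forall>\<^sub>F n in sequentially. 0 < q n \<and> q n \<le> 1 / 16"
  shows "as_gtrsim M \<xi> (\<lambda>n. log (1 / q n) (real n))"
proof -
  \<comment> \<open>The \<open>+ 1\<close> puts \<open>k\<close> above half of the logarithm while
    \<open>k - 1\<close>, the exponent of \<open>q\<close>, stays below it.\<close>
  define k where "k n = nat \<lfloor>log (1 / q n) (real n) / 2\<rfloor> + 1" for n
  show ?thesis
  proof (rule as_gtrsimI[of "\<lambda>n. real (k n)" "1 / 2"])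
    show "(\<lambda>n. prob {\<omega>\<in>space M. \<xi> n \<omega> < real (k n)}) \<longlonglongrightarrow> 0"
    proof (rule tendsto_sandwich[of "\<lambda>_. 0" _ _ "\<lambda>n. exp ((ln (real n))\<^sup>2 - sqrt (real n) / 2)"])
      have "\<forall>\<^sub>F n in sequentially. ln (real n) \<le> real n / 2" by real_asymp
      then show "\<forall>\<^sub>F n in sequentially. prob {\<omega>\<in>space M. \<xi> n \<omega> < real (k n)} \<le> exp ((ln (real n))\<^sup>2 - sqrt (real n) / 2)"
        using q' eventually_ge_at_top[of 8]
      proof eventually_elim
        case (elim n)
        define l where "l = ln (1 / q n)"
        \<comment> \<open>Through \<open>2 \<le> ln 8\<close> both \<open>ln n\<close> and
          \<open>ln (1 / q)\<close> are at least 2, which is enough for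
          \<open>k \<le> ln n\<close>.\<close>
        have "exp 2 \<le> (8 :: real)"
        proof -
          have "exp (1::real) * exp 1 \<le> 2.8 * 2.8" using e_less_272 by (intro mult_mono) auto
          then show ?thesis by (simp add: exp_add[symmetric])
        qed
        then have ln8: "2 \<le> ln (8::real)" by (simp add: ln_ge_iff)
        also have "\<dots> \<le> ln (real n)" using elim by simp
        finally have ln2: "2 \<le> ln (real n)" .
        have l: "2 \<le> l"
        proof -
          have "ln 8 \<le> ln (1 / q n)" using elim by (subst ln_le_cancel_iff) (auto simp: field_simps)
          then show ?thesis using ln8 by (simp add: l_def)
        qed
        have L: "log (1 / q n) (real n) = ln (real n) / l" by (simp add: log_def l_def)
        have kL: "real (k n - 1) \<le> ln (real n) / l / 2"
          using l ln2 by (simp add: k_def L)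
        also have "\<dots> \<le> ln (real n) / 2 / 2" using l ln2 by (intro divide_right_mono frac_le) auto
        finally have k_le: "real (k n) \<le> ln (real n)" using ln2 by (simp add: k_def)
        then have k_n: "k n \<le> n" using elim by linarith
        have "real (k n - 1) * l \<le> ln (real n) / 2" using kL l by (simp add: field_simps)
        then have "exp (- (ln (real n) / 2)) \<le> exp (- (real (k n - 1) * l))" by simp
        also have "\<dots> = q n ^ (k n - 1)"
          using elim by (simp add: l_def ln_div exp_of_nat_mult[symmetric] flip: exp_ln_iff) (simp add: exp_of_nat_mult)
        finally have qk: "exp (- (ln (real n) / 2)) \<le> q n ^ (k n - 1)" .
        have "(1 - q n ^ (k n - 1)) ^ (n - k n) \<le> exp (- (real (n - k n) * q n ^ (k n - 1)))"
          using exp_ge_add_one_self[of "- (q n ^ (k n - 1))"] q[of n]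
          by (intro power_le_exp) (auto simp: power_le_one)
        also have "real (n - k n) * q n ^ (k n - 1) \<ge> real n / 2 * exp (- (ln (real n) / 2))"
          using qk k_le k_n elim by (intro mult_mono) (auto simp: of_nat_diff)
        then have "exp (- (real (n - k n) * q n ^ (k n - 1))) \<le> exp (- (real n / 2 * exp (- (ln (real n) / 2))))"
          by simp
        also have "real n / 2 * exp (- (ln (real n) / 2)) = sqrt (real n) / 2"
        proof -
          have "exp (- (ln (real n) / 2)) = 1 / sqrt (real n)"
            using elim by (simp add: exp_minus powr_half_sqrt[symmetric] powr_def field_simps)
          then have "real n / 2 * exp (- (ln (real n) / 2)) = real n / sqrt (real n) / 2" by simp
          then show ?thesis by (simp only: real_div_sqrt of_nat_0_le_iff)
        qed
        finally have 1: "(1 - q n ^ (k n - 1)) ^ (n - k n) \<le> exp (- (sqrt (real n) / 2))" .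
        have "real n ^ k n = exp (real (k n) * ln (real n))" using elim by (simp add: exp_of_nat_mult)
        also have "\<dots> \<le> exp ((ln (real n))\<^sup>2)"
          using k_le ln2 by (simp add: power2_eq_square)
        finally have 2: "real n ^ k n \<le> exp ((ln (real n))\<^sup>2)" .
        have "prob {\<omega>\<in>space M. \<xi> n \<omega> < real (k n)} \<le> real n ^ k n * (1 - q n ^ (k n - 1)) ^ (n - k n)"
          using k_n by (intro prob_clique_number_less_inserted) (auto simp: k_def)
        also have "\<dots> \<le> exp ((ln (real n))\<^sup>2) * exp (- (sqrt (real n) / 2))"
          using 1 2 q[of n] by (intro mult_mono) (auto simp: power_le_one)
        finally show ?case by (simp add: exp_add[symmetric])
      qed
      show "(\<lambda>n. exp ((ln (real n))\<^sup>2 - sqrt (real n) / 2)) \<longlonglongrightarrow> 0" by real_asymp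
    qed auto
    show "\<forall>\<^sub>F n in sequentially. 1 / 2 * log (1 / q n) (real n) \<le> real (k n)"
      by (intro always_eventually allI) (simp add: k_def, linarith)
  qed simp
qed

text \<open>By \<open>s\<close> there are at least of order \<open>n / ln n\<close> heavy cells, and
  by \<open>hit\<close> each of them is hit by all groups with probability at least
  \<open>n^(-1/2)\<close>. The mean number of such cells tends to infinity, and the second moment
  bound makes its reciprocal the failure probability.\<close>

lemma as_gtrsim_cells:
  assumes ab: "a > 0" "b > 0" and cells: "\<And>s. 0 < s \<Longrightarrow> s \<le> 1 \<Longrightarrow>
    (\<exists>\<Q>. finite \<Q> \<and> disjoint \<Q> \<and> \<Q> \<subseteq> sets borel \<and> b \<le> real (card \<Q>) * s ^ DIM('a) \<and>
      (\<forall>Q\<in>\<Q>. a * s ^ DIM('a) \<le> measure \<nu> Q \<and> (\<forall>x\<in>Q. \<forall>y\<in>Q. N (x - y) \<le> s)))"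
    and r: "\<And>n. 0 < r n" "r \<longlonglongrightarrow> 0"
    and s: "\<forall>\<^sub>F n in sequentially. real n * r n ^ DIM('a) \<le> B * ln (real n)"
    and k: "\<forall>\<^sub>F n in sequentially. 1 \<le> k n \<and> k n \<le> n"
    and hit: "\<forall>\<^sub>F n in sequentially.
      exp (- (ln (real n) / 2)) \<le> (1 - exp (- (a * (real n * r n ^ DIM('a)) / (2 * real (k n))))) ^ k n"
    and c: "c > 0" "\<forall>\<^sub>F n in sequentially. c * K n \<le> real (k n)"
  shows "as_gtrsim M \<xi> K"
proof (rule as_gtrsimI[OF _ c])
  show "(\<lambda>n. prob {\<omega>\<in>space M. \<xi> n \<omega> < real (k n)}) \<longlonglongrightarrow> 0"
  proof (rule tendsto_sandwich[of "\<lambda>_. 0" _ _ "\<lambda>n. B * ln (real n) * exp (ln (real n) / 2) / (b * real n)"])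
    have "\<forall>\<^sub>F n in sequentially. r n < 1" using r(2) by (rule order_tendstoD) simp
    then show "\<forall>\<^sub>F n in sequentially. prob {\<omega>\<in>space M. \<xi> n \<omega> < real (k n)} \<le>
        B * ln (real n) * exp (ln (real n) / 2) / (b * real n)"
      using s k hit eventually_gt_at_top[of 0]
    proof eventually_elim
      case (elim n)
      define g where "g = n div k n"
      define p where "p = a * r n ^ DIM('a)"
      define h where "h = (1 - (1 - p) ^ g) ^ k n"
      obtain \<Q> where \<Q>: "finite \<Q>" "disjoint \<Q>" "\<Q> \<subseteq> sets borel" "b \<le> real (card \<Q>) * r n ^ DIM('a)"
        "\<And>Q. Q \<in> \<Q> \<Longrightarrow> p \<le> measure \<nu> Q"
        "\<And>Q x y. Q \<in> \<Q> \<Longrightarrow> x \<in> Q \<Longrightarrow> y \<in> Q \<Longrightarrow> N (x - y) \<le> r n"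
        using cells[of "r n"] r(1)[of n] elim unfolding p_def by (metis less_imp_le)
      interpret \<nu>: prob_space \<nu> by (rule bounded_density_prob_space[OF f])
      have rd: "0 < r n ^ DIM('a)" using r(1)[of n] by simp
      have "\<Q> \<noteq> {}" using \<Q>(4) ab by auto
      then obtain Q where "Q \<in> \<Q>" by blast
      then have p: "0 \<le> p" "p \<le> 1" using order_trans[OF \<Q>(5) \<nu>.prob_le_1, of Q] ab rd by (simp_all add: p_def)
      \<comment> \<open>Rounding in \<open>g = n div k\<close> loses at most a factor 2, which is
        the 2 in the denominator of \<open>hit\<close>.\<close>
      have "n < k n * g + k n"
        using div_mult_mod_eq[of n "k n"] mod_less_divisor[of "k n" n] elim unfolding g_def
        by (metis add_strict_left_mono mult.commute less_le_trans zero_less_one)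
      moreover have "g \<ge> 1" using elim unfolding g_def by (simp add: div_greater_zero_iff Suc_le_eq)
      then have "k n \<le> k n * g" by simp
      ultimately have "n \<le> 2 * (k n * g)" by linarith
      then have "real n \<le> 2 * (real (k n) * real g)" by (metis of_nat_le_iff of_nat_mult of_nat_numeral)
      then have g: "real n / (2 * real (k n)) \<le> real g" using elim by (simp add: field_simps)
      have "(1 - p) ^ g \<le> exp (- (real g * p))"
        using exp_ge_add_one_self[of "- p"] p by (intro power_le_exp) auto
      also have "\<dots> \<le> exp (- (real n / (2 * real (k n)) * p))"
        using mult_right_mono[OF g p(1)] by simp
      also have "real n / (2 * real (k n)) * p = a * (real n * r n ^ DIM('a)) / (2 * real (k n))"
        by (simp add: p_def)
      finally have "(1 - exp (- (a * (real n * r n ^ DIM('a)) / (2 * real (k n))))) ^ k n \<le> h"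
        unfolding h_def using ab rd by (intro power_mono diff_left_mono) auto
      then have h: "exp (- (ln (real n) / 2)) \<le> h" using elim by linarith
      let ?P = "prob {\<omega>\<in>space M. \<xi> n \<omega> < real (k n)}"
      have le1: "?P * (real (card \<Q>) * h) \<le> 1" unfolding h_def
        by (rule prob_clique_number_less_cells[OF \<Q>(1-3,5) p \<Q>(6)]) (auto simp: g_def)
      have "b * exp (- (ln (real n) / 2)) \<le> (real (card \<Q>) * r n ^ DIM('a)) * h"
        using \<Q>(4) h ab by (intro mult_mono) auto
      then have "?P * (b * exp (- (ln (real n) / 2))) \<le> ?P * ((real (card \<Q>) * r n ^ DIM('a)) * h)"
        by (intro mult_left_mono) auto
      also have "\<dots> = (?P * (real (card \<Q>) * h)) * r n ^ DIM('a)" by (simp add: ac_simps)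
      also have "\<dots> \<le> 1 * r n ^ DIM('a)" using le1 rd by (intro mult_right_mono) auto
      also have "\<dots> = real n * r n ^ DIM('a) / real n" using elim by simp
      also have "\<dots> \<le> B * ln (real n) / real n" using elim by (intro divide_right_mono) auto
      finally have "?P * (b * exp (- (ln (real n) / 2))) \<le> B * ln (real n) / real n" .
      then have "?P \<le> B * ln (real n) / real n / (b * exp (- (ln (real n) / 2)))"
        using ab by (subst pos_le_divide_eq) auto
      then show ?case by (simp add: exp_minus field_simps)
    qed
    show "(\<lambda>n. B * ln (real n) * exp (ln (real n) / 2) / (b * real n)) \<longlonglongrightarrow> 0"
      using ab(2) by real_asymp
  qed auto
qed

text \<open>Half of the exponent \<open>\<alpha>\<close> absorbs the constant \<open>e * A\<close>;
  the other half, raised to the power \<open>4 / \<alpha>\<close>, cancels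
  \<open>n^2\<close>.\<close>

lemma near_bound_polynomial:
  assumes A: "A > 0" and \<alpha>: "0 < \<alpha>" and r: "\<And>n. 0 < r n"
    and s: "\<forall>\<^sub>F n in sequentially. real n * r n ^ DIM('a) \<le> real n powr (- \<alpha>)"
    and j: "\<forall>\<^sub>F n in sequentially. 1 \<le> j n \<and> 4 / \<alpha> \<le> real (j n)"
  shows "\<forall>\<^sub>F n in sequentially.
    (real n)\<^sup>2 * (exp 1 * A * (real n * r n ^ DIM('a)) / real (j n)) ^ j n \<le> 1"
proof -
  have "\<forall>\<^sub>F n in sequentially. exp 1 * A * real n powr (- \<alpha>) \<le> real n powr (- (\<alpha> / 2))"
    using A \<alpha> by real_asymp
  then show ?thesis using s j eventually_ge_at_top[of 1]
  proof eventually_elim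
    case (elim n)
    let ?s = "real n * r n ^ DIM('a)"
    have s0: "0 \<le> ?s" using r[of n] by simp
    have "exp 1 * A * ?s / real (j n) \<le> exp 1 * A * ?s / 1"
      using elim A s0 by (intro divide_left_mono) auto
    also have "\<dots> \<le> exp 1 * A * real n powr (- \<alpha>)" using elim A by simp
    also have "\<dots> \<le> real n powr (- (\<alpha> / 2))" using elim by simp
    also have "\<dots> = exp (- (\<alpha> / 2 * ln (real n)))" using elim by (simp add: powr_def)
    finally have le: "exp 1 * A * ?s / real (j n) \<le> exp (- (\<alpha> / 2 * ln (real n)))" .
    have "2 \<le> real (j n) * (\<alpha> / 2)" using elim \<alpha> by (simp add: field_simps)
    then have "2 * ln (real n) \<le> real (j n) * (\<alpha> / 2) * ln (real n)"
      using elim by (intro mult_right_mono) auto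
    then show ?case using A s0 elim le by (intro power_mult_power_le_1[OF _ le]) (auto simp: mult.assoc)
  qed
qed

text \<open>Since \<open>n * r ^ d = ln n / u\<close>, inserting the lower bound on \<open>j\<close>
  turns the base into at most a constant times \<open>ln u / u\<close>, eventually below
  \<open>u^(-1/2)\<close>. Its power \<open>4 * ln n / ln u\<close> is
  \<open>n^(-2)\<close>.\<close>

lemma near_bound_subpolynomial:
  fixes u :: "nat \<Rightarrow> real"
  assumes A: "A > 0" and r: "\<And>n. 0 < r n"
    and u: "filterlim u at_top sequentially" "\<And>n. u n = ln (real n) / (real n * r n ^ DIM('a))"
    and j: "\<forall>\<^sub>F n in sequentially. 4 * (ln (real n) / ln (u n)) \<le> real (j n)"
  shows "\<forall>\<^sub>F n in sequentially.
    (real n)\<^sup>2 * (exp 1 * A * (real n * r n ^ DIM('a)) / real (j n)) ^ j n \<le> 1"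
proof -
  have "\<forall>\<^sub>F x in at_top. exp 1 * A * ln x / (4 * x) \<le> x powr (- (1 / 2))" using A by real_asymp
  then have "\<forall>\<^sub>F n in sequentially. exp 1 * A * ln (u n) / (4 * u n) \<le> u n powr (- (1 / 2))"
    using u(1) by (rule eventually_compose_filterlim)
  moreover have "\<forall>\<^sub>F n in sequentially. 1 < u n" using u(1) by (simp add: filterlim_at_top_dense)
  ultimately show ?thesis using j eventually_ge_at_top[of 2]
  proof eventually_elim
    case (elim n)
    let ?s = "real n * r n ^ DIM('a)"
    have s0: "0 < ?s" using r[of n] elim by simp
    have ln_pos: "0 < ln (real n)" "0 < ln (u n)" using elim by auto
    define L where "L = ln (real n) / ln (u n)"
    have L: "0 < L" using ln_pos by (simp add: L_def)
    have s_eq: "?s = ln (real n) / u n" using s0 ln_pos unfolding u(2) by simp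
    have jL: "4 * L \<le> real (j n)" using elim by (simp add: L_def)
    with L have jL_pos: "0 < real (j n) * (4 * L)" by (intro mult_pos_pos) linarith+
    have "exp 1 * A * ?s / real (j n) \<le> exp 1 * A * ?s / (4 * L)"
      using jL jL_pos A s0 by (intro divide_left_mono) (auto simp del: of_nat_0_less_iff)
    also have "\<dots> = exp 1 * A * ln (u n) / (4 * u n)"
      using ln_pos elim unfolding s_eq L_def by (simp add: field_simps)
    also have "\<dots> \<le> u n powr (- (1 / 2))" using elim by simp
    also have "\<dots> = exp (- (ln (u n) / 2))" using elim by (simp add: powr_def)
    finally have le: "exp 1 * A * ?s / real (j n) \<le> exp (- (ln (u n) / 2))" .
    have "4 * ln (real n) \<le> real (j n) * ln (u n)" using elim ln_pos by (simp add: field_simps)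
    then show ?case using A s0 elim le by (intro power_mult_power_le_1[OF _ le]) auto
  qed
qed

text \<open>Shared by the two regimes of large \<open>q\<close>. Only \<open>near\<close> depends on
  the radius, so it remains a hypothesis; \<open>L\<close> lets the rounding of \<open>j\<close> be
  absorbed into the factor \<open>J + 1\<close>.\<close>

lemma as_sim_log:
  assumes r: "\<And>n. 0 < r n"
    and A: "A > 0" "\<And>x s. s > 0 \<Longrightarrow> measure \<nu> {y. N (y - x) \<le> s} \<le> A * s ^ DIM('a)"
    and J: "6 \<le> J"
    and q': "\<forall>\<^sub>F n in sequentially. 0 < q n \<and> q n \<le> 1 / 16"
    and L: "\<forall>\<^sub>F n in sequentially. 1 \<le> log (1 / q n) (real n)"
    and near: "\<And>j. \<forall>\<^sub>F n in sequentially. J * log (1 / q n) (real n) \<le> real (j n) \<Longrightarrow>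
      \<forall>\<^sub>F n in sequentially. (real n)\<^sup>2 * (exp 1 * A * (real n * r n ^ DIM('a)) / real (j n)) ^ j n \<le> 1"
  shows "as_sim M \<xi> (\<lambda>n. log (1 / q n) (real n))"
  unfolding as_sim_def
proof
  show "as_gtrsim M \<xi> (\<lambda>n. log (1 / q n) (real n))" by (rule as_gtrsim_inserted[OF q'])
  define j where "j n = nat \<lceil>J * log (1 / q n) (real n)\<rceil>" for n
  have j_ge: "J * log (1 / q n) (real n) \<le> real (j n)" for n unfolding j_def by linarith
  show "as_lesssim M \<xi> (\<lambda>n. log (1 / q n) (real n))"
  proof (rule as_lesssim_of_bounds[OF A r, of j "J + 1"])
    show "\<forall>\<^sub>F n in sequentially. 1 \<le> j n" using L
    proof eventually_elim
      case (elim n)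
      then have "1 \<le> J * log (1 / q n) (real n)" using J mult_mono[of 1 J 1] by simp
      then have "1 \<le> real (j n)" using j_ge[of n] by linarith
      then show ?case by simp
    qed
    show "\<forall>\<^sub>F n in sequentially. (real n)\<^sup>2 * (exp 1 * A * (real n * r n ^ DIM('a)) / real (j n)) ^ j n \<le> 1"
      using j_ge by (intro near always_eventually) auto
    show "\<forall>\<^sub>F n in sequentially. real n ^ 3 * (4 * q n) ^ j n \<le> 1"
      using q' L eventually_ge_at_top[of 2]
    proof eventually_elim
      case (elim n)
      define l where "l = ln (1 / q n)"
      have l: "0 < l" using elim by (simp add: l_def)
      have q_eq: "q n = exp (- l)" using elim by (simp add: l_def ln_div)
      \<comment> \<open>The origin of \<open>1 / 16\<close>: then \<open>4 * q\<close> is at most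
        the square root of \<open>q\<close>, and its power \<open>6 * log_{1/q} n\<close> is at most
        \<open>n^(-3)\<close>.\<close>
      have "(4 * q n)\<^sup>2 \<le> q n" using elim by (simp add: power2_eq_square)
      also have "\<dots> = (exp (- (l / 2)))\<^sup>2" unfolding q_eq by (simp add: exp_double[symmetric])
      finally have le: "4 * q n \<le> exp (- (l / 2))" by (rule power2_le_imp_le) simp
      have "6 * (ln (real n) / l) \<le> J * (ln (real n) / l)" using J l elim by (intro mult_right_mono) auto
      also have "\<dots> \<le> real (j n)" using j_ge[of n] by (simp add: log_def l_def)
      finally have "6 * ln (real n) \<le> real (j n) * l" using l by (simp add: field_simps)
      then show ?case using elim by (intro power_mult_power_le_1[OF _ le]) auto
    qed
    show "\<forall>\<^sub>F n in sequentially. real (j n) \<le> (J + 1) * log (1 / q n) (real n)" using L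
    proof eventually_elim
      case (elim n)
      then have "0 \<le> J * log (1 / q n) (real n)" using J by simp
      then have "real (j n) \<le> J * log (1 / q n) (real n) + 1" unfolding j_def by linarith
      then show ?case using elim by (simp add: distrib_right)
    qed
  qed (use J in auto)
qed

text \<open>A constant \<open>j\<close> satisfies the near condition. It satisfies the far one as
  well if \<open>q \<le> 1 / n\<close>; above this threshold \<open>log_{1/q} n\<close> is at least
  1, so its multiples exceed the required constant.\<close>

lemma as_sim_polynomial:
  assumes r: "\<And>n. 0 < r n" and \<alpha>: "0 < \<alpha>"
    and s: "\<forall>\<^sub>F n in sequentially. real n * r n ^ DIM('a) \<le> real n powr (- \<alpha>)"
  shows "\<forall>\<^sub>F n in sequentially. q n \<le> 1 / real n \<Longrightarrow> as_sim M \<xi> (\<lambda>n. 1)"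
    and "\<forall>\<^sub>F n in sequentially. 1 / real n < q n \<and> q n \<le> 1 / 16 \<Longrightarrow>
      as_sim M \<xi> (\<lambda>n. log (1 / q n) (real n))"
proof -
  obtain A where A: "A > 0" "\<And>x s. s > 0 \<Longrightarrow> measure \<nu> {y. N (y - x) \<le> s} \<le> A * s ^ DIM('a)"
    using ball_mass_le[OF f N] by blast
  note near = near_bound_polynomial[OF A(1) \<alpha> r s]
  show "as_sim M \<xi> (\<lambda>n. 1)" if q': "\<forall>\<^sub>F n in sequentially. q n \<le> 1 / real n"
    unfolding as_sim_def
  proof
    \<comment> \<open>\<open>4 / \<alpha>\<close> serves the near condition; 4 serves the far one,
      where the base is at most \<open>n^(-3/4)\<close>.\<close>
    define J where "J = nat \<lceil>max 4 (4 / \<alpha>)\<rceil>"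
    have J: "4 \<le> real J" "4 / \<alpha> \<le> real J" unfolding J_def by linarith+
    show "as_lesssim M \<xi> (\<lambda>n. 1)"
    proof (rule as_lesssim_of_bounds[OF A r, of "\<lambda>_. J" "real J"])
      show "\<forall>\<^sub>F n in sequentially. (real n)\<^sup>2 * (exp 1 * A * (real n * r n ^ DIM('a)) / real J) ^ J \<le> 1"
        using J by (intro near) auto
      have "\<forall>\<^sub>F n in sequentially. 4 / real n \<le> exp (- (3 / 4 * ln (real n)))" by real_asymp
      then show "\<forall>\<^sub>F n in sequentially. real n ^ 3 * (4 * q n) ^ J \<le> 1"
        using q' eventually_ge_at_top[of 1]
      proof eventually_elim
        case (elim n)
        have le: "4 * q n \<le> exp (- (3 / 4 * ln (real n)))" using elim by simp
        have "4 * (3 / 4 * ln (real n)) \<le> real J * (3 / 4 * ln (real n))"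
          using J elim by (intro mult_right_mono) auto
        then show ?case using elim q[of n] by (intro power_mult_power_le_1[OF _ le]) auto
      qed
    qed (use J in auto)
  qed (rule as_gtrsim_one)
  show "as_sim M \<xi> (\<lambda>n. log (1 / q n) (real n))"
    if q': "\<forall>\<^sub>F n in sequentially. 1 / real n < q n \<and> q n \<le> 1 / 16"
  proof -
    have q'': "\<forall>\<^sub>F n in sequentially. 0 < q n \<and> q n \<le> 1 / 16"
      using q'
    proof eventually_elim
      case (elim n)
      then show ?case using divide_nonneg_nonneg[of 1 "real n"] by linarith
    qed
    have L: "\<forall>\<^sub>F n in sequentially. 1 \<le> log (1 / q n) (real n)"
      using q' q'' eventually_ge_at_top[of 1]
    proof eventually_elim
      case (elim n)
      then have "1 / q n \<le> real n" "1 < 1 / q n" by (auto simp: field_simps)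
      then show ?case by (subst le_log_iff) auto
    qed
    show ?thesis
    proof (rule as_sim_log[OF r A _ q'' L, where J = "max 6 (4 / \<alpha>)"])
      fix j :: "nat \<Rightarrow> nat" assume j: "\<forall>\<^sub>F n in sequentially. max 6 (4 / \<alpha>) * log (1 / q n) (real n) \<le> real (j n)"
      have "\<forall>\<^sub>F n in sequentially. 1 \<le> j n \<and> 4 / \<alpha> \<le> real (j n)"
        using j L
      proof eventually_elim
        case (elim n)
        have "max 6 (4 / \<alpha>) * 1 \<le> max 6 (4 / \<alpha>) * log (1 / q n) (real n)"
          using elim by (intro mult_left_mono) auto
        with elim have "max 6 (4 / \<alpha>) \<le> real (j n)" by linarith
        then show ?case by simp
      qed
      then show "\<forall>\<^sub>F n in sequentially. (real n)\<^sup>2 * (exp 1 * A * (real n * r n ^ DIM('a)) / real (j n)) ^ j n \<le> 1"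
        by (rule near)
    qed (auto simp: le_max_iff_disj)
  qed
qed

text \<open>With \<open>L = ln n / ln u\<close>, \<open>q \<le> 1 / u\<close> makes multiples of
  \<open>L\<close> sufficient for both conditions, and a cell with about \<open>L / 2\<close> points
  supplies the lower bound. If \<open>q > 1 / u\<close>, then \<open>L \<le> log_{1/q} n\<close> and
  insertions dominate.\<close>

lemma as_sim_subpolynomial:
  fixes u :: "nat \<Rightarrow> real"
  assumes r: "\<And>n. 0 < r n" "r \<longlonglongrightarrow> 0"
    and s_ge: "(\<lambda>n. real n powr (- (1 / 8)) / (real n * r n ^ DIM('a))) \<longlonglongrightarrow> 0"
    and s_le: "(\<lambda>n. real n * r n ^ DIM('a) / ln (real n)) \<longlonglongrightarrow> 0"
    and u: "\<And>n. u n = ln (real n) / (real n * r n ^ DIM('a))"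
  shows "\<forall>\<^sub>F n in sequentially. q n \<le> 1 / u n \<Longrightarrow> as_sim M \<xi> (\<lambda>n. ln (real n) / ln (u n))"
    and "\<forall>\<^sub>F n in sequentially. 1 / u n < q n \<and> q n \<le> 1 / 16 \<Longrightarrow>
      as_sim M \<xi> (\<lambda>n. log (1 / q n) (real n))"
proof -
  obtain A where A: "A > 0" "\<And>x s. s > 0 \<Longrightarrow> measure \<nu> {y. N (y - x) \<le> s} \<le> A * s ^ DIM('a)"
    using ball_mass_le[OF f N] by blast
  define L where "L n = ln (real n) / ln (u n)" for n
  have s_pos: "\<forall>\<^sub>F n in sequentially. 0 < real n * r n ^ DIM('a)"
    using r(1) by (intro eventually_sequentiallyI[of 1]) auto
  have u_lim: "filterlim u at_top sequentially"
  proof -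
    have "\<forall>\<^sub>F n in sequentially. 0 < real n * r n ^ DIM('a) / ln (real n)"
      using s_pos eventually_ge_at_top[of 2] by eventually_elim simp
    from filterlim_inverse_at_top[OF s_le this] show ?thesis
      unfolding u by (simp add: filterlim_cong[OF refl refl])
  qed
  have u_ge: "\<forall>\<^sub>F n in sequentially. C \<le> u n" for C
    using u_lim by (simp add: filterlim_at_top)
  \<comment> \<open>The exponent \<open>1 / 8\<close> gives \<open>u \<le> n^(1/8) * ln n\<close>,
    eventually at most \<open>n^(1/4)\<close>. Having \<open>L \<ge> 4\<close> leaves room for
    rounding \<open>L / 2\<close> down.\<close>
  have L_ge: "\<forall>\<^sub>F n in sequentially. 4 \<le> L n"
  proof -
    have "\<forall>\<^sub>F n in sequentially. real n powr (- (1 / 8)) / (real n * r n ^ DIM('a)) < 1"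
      using s_ge by (rule order_tendstoD) simp
    moreover have "\<forall>\<^sub>F n in sequentially. ln (real n) / real n powr (- (1 / 8)) \<le> exp (ln (real n) / 4)"
      by real_asymp
    ultimately show ?thesis using s_pos u_ge[of 2] eventually_ge_at_top[of 2]
    proof eventually_elim
      case (elim n)
      have "real n powr (- (1 / 8)) \<le> real n * r n ^ DIM('a)" using elim by (simp add: field_simps)
      then have "u n \<le> ln (real n) / real n powr (- (1 / 8))"
        unfolding u using elim by (intro divide_left_mono) auto
      also have "\<dots> \<le> exp (ln (real n) / 4)" using elim by simp
      finally have "ln (u n) \<le> ln (exp (ln (real n) / 4))" using elim by (subst ln_le_cancel_iff) auto
      then have "ln (u n) \<le> ln (real n) / 4" by simp
      moreover have "0 < ln (u n)" using elim by simp
      ultimately show ?case by (simp add: L_def field_simps)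
    qed
  qed
  note near = near_bound_subpolynomial[OF A(1) r(1) u_lim u, folded L_def]
  show "as_sim M \<xi> (\<lambda>n. ln (real n) / ln (u n))" if q': "\<forall>\<^sub>F n in sequentially. q n \<le> 1 / u n"
    unfolding as_sim_def L_def[symmetric]
  proof
    \<comment> \<open>The far condition dictates the 6: with base at most \<open>u^(-1/2)\<close>,
      the power \<open>6 * L\<close> gives \<open>n^(-3)\<close>.\<close>
    define j where "j n = nat \<lceil>6 * L n\<rceil>" for n
    have j_ge: "6 * L n \<le> real (j n)" for n unfolding j_def by linarith
    have L_j: "\<forall>\<^sub>F n in sequentially. 4 \<le> L n \<and> 4 * L n \<le> real (j n)"
      using L_ge
    proof eventually_elim
      case (elim n)
      then show ?case using j_ge[of n] by linarith
    qed
    show "as_lesssim M \<xi> L"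
    proof (rule as_lesssim_of_bounds[OF A r(1), of j 7])
      show "\<forall>\<^sub>F n in sequentially. 1 \<le> j n" using L_j
      proof eventually_elim
        case (elim n)
        then have "1 \<le> real (j n)" by linarith
        then show ?case by simp
      qed
      show "\<forall>\<^sub>F n in sequentially. (real n)\<^sup>2 * (exp 1 * A * (real n * r n ^ DIM('a)) / real (j n)) ^ j n \<le> 1"
        using L_j by (intro near) (auto elim: eventually_mono)
      have "\<forall>\<^sub>F x in at_top. 4 / x \<le> exp (- (ln x / 2 :: real))" by real_asymp
      then have "\<forall>\<^sub>F n in sequentially. 4 / u n \<le> exp (- (ln (u n) / 2))"
        using u_lim by (rule eventually_compose_filterlim)
      then show "\<forall>\<^sub>F n in sequentially. real n ^ 3 * (4 * q n) ^ j n \<le> 1"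
        using q' u_ge[of 2] eventually_ge_at_top[of 1]
      proof eventually_elim
        case (elim n)
        have le: "4 * q n \<le> exp (- (ln (u n) / 2))" using elim by simp
        have "6 * ln (real n) \<le> real (j n) * ln (u n)"
          using j_ge[of n] elim by (simp add: L_def field_simps)
        then show ?case using elim q[of n] by (intro power_mult_power_le_1[OF _ le]) auto
      qed
      show "\<forall>\<^sub>F n in sequentially. real (j n) \<le> 7 * L n" using L_ge
      proof eventually_elim
        case (elim n)
        then show ?case unfolding j_def by linarith
      qed
    qed auto
    obtain a b where ab: "a > 0" "b > 0" and cells: "\<And>s. 0 < s \<Longrightarrow> s \<le> 1 \<Longrightarrow>
        (\<exists>\<Q>. finite \<Q> \<and> disjoint \<Q> \<and> \<Q> \<subseteq> sets borel \<and> b \<le> real (card \<Q>) * s ^ DIM('a) \<and>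
          (\<forall>Q\<in>\<Q>. a * s ^ DIM('a) \<le> measure \<nu> Q \<and> (\<forall>x\<in>Q. \<forall>y\<in>Q. N (x - y) \<le> s)))"
      using heavy_cells[OF f N] by blast
    \<comment> \<open>\<open>k \<le> L / 2\<close> is chosen so that \<open>(1 / u) ^ k\<close> is
      at least \<open>n^(-1/2)\<close>.\<close>
    define k where "k n = nat \<lfloor>L n / 2\<rfloor>" for n
    have k: "\<forall>\<^sub>F n in sequentially. L n / 4 \<le> real (k n) \<and> real (k n) \<le> L n / 2" using L_ge
    proof eventually_elim
      case (elim n)
      then show ?case unfolding k_def by linarith
    qed
    show "as_gtrsim M \<xi> L"
    proof (rule as_gtrsim_cells[OF ab cells r, of 1 k "1 / 4"])
      have "\<forall>\<^sub>F n in sequentially. real n * r n ^ DIM('a) / ln (real n) < 1"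
        using s_le by (rule order_tendstoD) simp
      then show "\<forall>\<^sub>F n in sequentially. real n * r n ^ DIM('a) \<le> 1 * ln (real n)"
        using eventually_ge_at_top[of 2] by eventually_elim (simp add: field_simps)
      show "\<forall>\<^sub>F n in sequentially. 1 \<le> k n \<and> k n \<le> n"
        using k L_ge u_ge[of "exp 1"] eventually_ge_at_top[of 2]
      proof eventually_elim
        case (elim n)
        then have "1 \<le> real (k n)" by linarith
        have "0 < u n" using elim exp_gt_zero[of "1::real"] by linarith
        then have "1 \<le> ln (u n)" using elim by (simp add: ln_ge_iff)
        then have "L n \<le> ln (real n) / 1" unfolding L_def using elim by (intro divide_left_mono) auto
        also have "\<dots> \<le> real n" using ln_le_minus_one[of "real n"] elim by simp
        finally have "real (k n) \<le> real n" using elim by linarith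
        with \<open>1 \<le> real (k n)\<close> show ?case by simp
      qed
      \<comment> \<open>Since \<open>2 * k \<le> L\<close>, a group hits a given heavy cell with
        probability at least \<open>1 - exp (- a * ln u / u)\<close>; the growing factor
        \<open>ln u\<close> makes this at least \<open>1 / u\<close> whatever \<open>a\<close>
        is.\<close>
      have "\<forall>\<^sub>F x in at_top. 1 / x \<le> 1 - exp (- (a * ln x / x))" using ab by real_asymp
      then have "\<forall>\<^sub>F n in sequentially. 1 / u n \<le> 1 - exp (- (a * ln (u n) / u n))"
        using u_lim by (rule eventually_compose_filterlim)
      then show "\<forall>\<^sub>F n in sequentially. exp (- (ln (real n) / 2)) \<le>
          (1 - exp (- (a * (real n * r n ^ DIM('a)) / (2 * real (k n))))) ^ k n"
        using k L_ge u_ge[of 2] s_pos eventually_ge_at_top[of 2]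
      proof eventually_elim
        case (elim n)
        let ?s = "real n * r n ^ DIM('a)"
        have ln_pos: "0 < ln (real n)" "0 < ln (u n)" using elim by auto
        have s_eq: "?s = ln (real n) / u n" using elim ln_pos unfolding u by simp
        have "a * ln (u n) / u n = a * ?s / L n"
          unfolding s_eq L_def using ln_pos by simp
        also have "\<dots> \<le> a * ?s / (2 * real (k n))" using elim ab by (intro divide_left_mono) auto
        finally have "exp (- (a * ?s / (2 * real (k n)))) \<le> exp (- (a * ln (u n) / u n))" by simp
        with elim have y: "1 / u n \<le> 1 - exp (- (a * ?s / (2 * real (k n))))" by linarith
        have "real (k n) * ln (u n) \<le> L n / 2 * ln (u n)" using elim ln_pos by (intro mult_right_mono) auto
        also have "\<dots> = ln (real n) / 2" using ln_pos by (simp add: L_def)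
        finally have "exp (- (ln (real n) / 2)) \<le> exp (- (real (k n) * ln (u n)))" by simp
        also have "\<dots> = (1 / u n) ^ k n"
          using elim by (simp add: exp_minus exp_of_nat_mult power_one_over inverse_eq_divide)
        also have "\<dots> \<le> (1 - exp (- (a * ?s / (2 * real (k n))))) ^ k n"
          using y elim by (intro power_mono) auto
        finally show ?case .
      qed
      show "\<forall>\<^sub>F n in sequentially. 1 / 4 * L n \<le> real (k n)" using k by eventually_elim simp
    qed auto
  qed
  show "as_sim M \<xi> (\<lambda>n. log (1 / q n) (real n))"
    if q': "\<forall>\<^sub>F n in sequentially. 1 / u n < q n \<and> q n \<le> 1 / 16"
  proof -
    have q'': "\<forall>\<^sub>F n in sequentially. 0 < q n \<and> q n \<le> 1 / 16"
      using q' u_ge[of 1]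
    proof eventually_elim
      case (elim n)
      then show ?case using divide_nonneg_nonneg[of 1 "u n"] by linarith
    qed
    have L: "\<forall>\<^sub>F n in sequentially. 4 \<le> log (1 / q n) (real n) \<and> L n \<le> log (1 / q n) (real n)"
      using q' q'' u_ge[of 2] L_ge eventually_ge_at_top[of 2]
    proof eventually_elim
      case (elim n)
      have "1 / q n \<le> u n" "1 < 1 / q n" using elim by (auto simp: field_simps)
      then have "ln (1 / q n) \<le> ln (u n)" "0 < ln (1 / q n)" using elim by auto
      then have "L n \<le> log (1 / q n) (real n)"
        unfolding L_def log_def using elim by (intro divide_left_mono) auto
      then show ?case using elim by simp
    qed
    show ?thesis
    proof (rule as_sim_log[OF r(1) A _ q'', where J = 6])
      show "\<forall>\<^sub>F n in sequentially. 1 \<le> log (1 / q n) (real n)" using L by eventually_elim simp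
      fix j :: "nat \<Rightarrow> nat" assume j: "\<forall>\<^sub>F n in sequentially. 6 * log (1 / q n) (real n) \<le> real (j n)"
      have "\<forall>\<^sub>F n in sequentially. 4 * L n \<le> real (j n)" using j L by eventually_elim linarith
      then show "\<forall>\<^sub>F n in sequentially. (real n)\<^sup>2 * (exp 1 * A * (real n * r n ^ DIM('a)) / real (j n)) ^ j n \<le> 1"
        by (rule near)
    qed auto
  qed
qed

text \<open>Here \<open>n * r ^ d\<close> and \<open>ln n\<close> are of the same order, so bases
  that are constants below 1 suffice: with the right multiples, \<open>exp (- j)\<close> is small
  enough above and \<open>exp (- k)\<close> large enough below.\<close>

lemma as_sim_logarithmic:
  assumes r: "\<And>n. 0 < r n" "r \<longlonglongrightarrow> 0"
    and s: "(\<lambda>n. real n * r n ^ DIM('a) / ln (real n)) \<longlonglongrightarrow> \<tau>" "0 < \<tau>"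
    and q': "\<forall>\<^sub>F n in sequentially. q n \<le> 1 / 16"
  shows "as_sim M \<xi> (\<lambda>n. real n * r n ^ DIM('a))"
  unfolding as_sim_def
proof
  let ?s = "\<lambda>n. real n * r n ^ DIM('a)"
  have s_bounds: "\<forall>\<^sub>F n in sequentially. \<tau> / 2 * ln (real n) \<le> ?s n \<and> ?s n \<le> 2 * \<tau> * ln (real n)"
  proof -
    have "\<forall>\<^sub>F n in sequentially. \<tau> / 2 < ?s n / ln (real n)" using s by (intro order_tendstoD) auto
    moreover have "\<forall>\<^sub>F n in sequentially. ?s n / ln (real n) < 2 * \<tau>" using s by (intro order_tendstoD) auto
    ultimately show ?thesis using eventually_ge_at_top[of 2]
      by eventually_elim (simp add: field_simps)
  qed
  have s_ge: "\<forall>\<^sub>F n in sequentially. C \<le> ?s n" for C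
  proof -
    have "\<forall>\<^sub>F n in sequentially. C \<le> \<tau> / 2 * ln (real n)" using s(2) by real_asymp
    with s_bounds show ?thesis by eventually_elim linarith
  qed
  obtain A where A: "A > 0" "\<And>x s. s > 0 \<Longrightarrow> measure \<nu> {y. N (y - x) \<le> s} \<le> A * s ^ DIM('a)"
    using ball_mass_le[OF f N] by blast
  \<comment> \<open>The first entry brings the near base down to \<open>exp (- 1)\<close>; the
    second gives \<open>j \<ge> 3 * ln n\<close>, hence
    \<open>exp (- j) \<le> n^(-3)\<close>.\<close>
  define J where "J = max (exp 2 * A) (6 / \<tau>)"
  have J: "0 < J" "exp 2 * A \<le> J" "3 \<le> J * (\<tau> / 2)" using A s(2) by (auto simp: J_def max_def field_simps)
  define j where "j n = nat \<lceil>J * ?s n\<rceil>" for n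
  have j_ge: "J * ?s n \<le> real (j n)" for n unfolding j_def by linarith
  have j_ln: "\<forall>\<^sub>F n in sequentially. 3 * ln (real n) \<le> real (j n)"
    using s_bounds eventually_ge_at_top[of 1]
  proof eventually_elim
    case (elim n)
    have "3 * ln (real n) \<le> J * (\<tau> / 2) * ln (real n)" using J elim by (intro mult_right_mono) auto
    also have "\<dots> \<le> J * ?s n" using J elim by (simp add: mult.assoc)
    finally show ?case using j_ge[of n] by linarith
  qed
  show "as_lesssim M \<xi> ?s"
  proof (rule as_lesssim_of_bounds[OF A r(1), of j "J + 1"])
    show "\<forall>\<^sub>F n in sequentially. 1 \<le> j n" using s_ge[of "1 / J"]
    proof eventually_elim
      case (elim n)
      then have "1 \<le> real (j n)" using j_ge[of n] J by (simp add: field_simps)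
      then show ?case by simp
    qed
    show "\<forall>\<^sub>F n in sequentially. (real n)\<^sup>2 * (exp 1 * A * ?s n / real (j n)) ^ j n \<le> 1"
      using s_ge[of 1] j_ln eventually_ge_at_top[of 1]
    proof eventually_elim
      case (elim n)
      have "exp 2 * A * ?s n \<le> J * ?s n" using J elim by (intro mult_right_mono) auto
      then have j_ge': "exp 2 * A * ?s n \<le> real (j n)" using j_ge[of n] by linarith
      have "0 < ?s n" using elim by linarith
      then have pos: "0 < exp 2 * A * ?s n" by (rule mult_pos_pos[OF mult_pos_pos[OF exp_gt_zero A(1)]])
      with j_ge' have "0 < real (j n)" by linarith
      from mult_pos_pos[OF this pos] have "0 < real (j n) * (exp 2 * A * ?s n)" .
      then have "exp 1 * A * ?s n / real (j n) \<le> exp 1 * A * ?s n / (exp 2 * A * ?s n)"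
        using j_ge' A elim by (intro divide_left_mono) auto
      also have "\<dots> = exp 1 / exp 2" using A(1) elim r(1)[of n] by simp
      also have "\<dots> = exp (- 1)" by (simp add: exp_diff[symmetric])
      finally have le: "exp 1 * A * ?s n / real (j n) \<le> exp (- 1)" .
      have "0 \<le> ln (real n)" using elim by simp
      then have "2 * ln (real n) \<le> real (j n)" using elim by linarith
      then show ?case using elim A by (intro power_mult_power_le_1[OF _ le]) auto
    qed
    show "\<forall>\<^sub>F n in sequentially. real n ^ 3 * (4 * q n) ^ j n \<le> 1"
      using q' j_ln eventually_ge_at_top[of 1]
    proof eventually_elim
      case (elim n)
      have "4 * q n \<le> 1 / 4" using elim by simp
      also have "\<dots> \<le> exp (- 1)" using e_less_272 by (simp add: exp_minus field_simps)
      finally have le: "4 * q n \<le> exp (- 1)" .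
      show ?case using elim q[of n] by (intro power_mult_power_le_1[OF _ le]) auto
    qed
    show "\<forall>\<^sub>F n in sequentially. real (j n) \<le> (J + 1) * ?s n" using s_ge[of 1]
    proof eventually_elim
      case (elim n)
      then have "0 \<le> J * ?s n" using J by simp
      then have "real (j n) \<le> J * ?s n + 1" unfolding j_def by linarith
      then show ?case using elim by (simp add: distrib_right)
    qed
  qed (use J in auto)
  obtain a b where ab: "a > 0" "b > 0" and cells: "\<And>s. 0 < s \<Longrightarrow> s \<le> 1 \<Longrightarrow>
      (\<exists>\<Q>. finite \<Q> \<and> disjoint \<Q> \<and> \<Q> \<subseteq> sets borel \<and> b \<le> real (card \<Q>) * s ^ DIM('a) \<and>
        (\<forall>Q\<in>\<Q>. a * s ^ DIM('a) \<le> measure \<nu> Q \<and> (\<forall>x\<in>Q. \<forall>y\<in>Q. N (x - y) \<le> s)))"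
    using heavy_cells[OF f N] by blast
  \<comment> \<open>\<open>a / 2\<close> makes the exponent in \<open>hit\<close> at least 1, so a
    group hits with probability at least \<open>1 - 1 / e \<ge> 1 / e\<close>; the other entry gives
    \<open>k \<le> ln n / 2\<close>.\<close>
  define c where "c = min (a / 2) (1 / (4 * \<tau>))"
  have c: "0 < c" "2 * c \<le> a" "c * (2 * \<tau>) \<le> 1 / 2"
    using ab s(2) by (auto simp: c_def min_def field_simps)
  define k where "k n = nat \<lfloor>c * ?s n\<rfloor>" for n
  have k: "\<forall>\<^sub>F n in sequentially. 1 \<le> real (k n) \<and> c / 2 * ?s n \<le> real (k n) \<and> real (k n) \<le> c * ?s n"
    using s_ge[of "2 / c"]
  proof eventually_elim
    case (elim n)
    then have "2 \<le> c * ?s n" using c by (simp add: field_simps)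
    then have "1 \<le> real (k n)" "c * ?s n - 1 \<le> real (k n)" "real (k n) \<le> c * ?s n"
      unfolding k_def by linarith+
    with \<open>2 \<le> c * ?s n\<close> show ?case by simp
  qed
  have k_ln: "\<forall>\<^sub>F n in sequentially. real (k n) \<le> ln (real n) / 2"
    using k s_bounds eventually_ge_at_top[of 1]
  proof eventually_elim
    case (elim n)
    have "real (k n) \<le> c * ?s n" using elim by simp
    also have "\<dots> \<le> c * (2 * \<tau> * ln (real n))" using elim c by (intro mult_left_mono) auto
    also have "\<dots> = c * (2 * \<tau>) * ln (real n)" by simp
    also have "\<dots> \<le> 1 / 2 * ln (real n)" using c elim by (intro mult_right_mono) auto
    finally show ?case by simp
  qed
  show "as_gtrsim M \<xi> ?s"
  proof (rule as_gtrsim_cells[OF ab cells r, of "2 * \<tau>" k "c / 2"])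
    show "\<forall>\<^sub>F n in sequentially. ?s n \<le> 2 * \<tau> * ln (real n)" using s_bounds by eventually_elim simp
    show "\<forall>\<^sub>F n in sequentially. 1 \<le> k n \<and> k n \<le> n"
      using k k_ln eventually_ge_at_top[of 1]
    proof eventually_elim
      case (elim n)
      then have "real (k n) \<le> real n" using ln_le_minus_one[of "real n"] by simp
      with elim show ?case by simp
    qed
    show "\<forall>\<^sub>F n in sequentially. exp (- (ln (real n) / 2)) \<le>
        (1 - exp (- (a * ?s n / (2 * real (k n))))) ^ k n"
      using k k_ln s_ge[of 1]
    proof eventually_elim
      case (elim n)
      have "2 * real (k n) \<le> 2 * c * ?s n" using elim by simp
      also have "\<dots> \<le> a * ?s n" using c elim by (intro mult_right_mono) auto
      finally have "1 \<le> a * ?s n / (2 * real (k n))" using elim by (simp add: field_simps)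
      then have "exp (- (a * ?s n / (2 * real (k n)))) \<le> exp (- 1)" by simp
      moreover have "exp (- 1) \<le> 1 - exp (- 1 :: real)"
        using exp_ge_add_one_self[of "1::real"] by (simp add: exp_minus field_simps)
      ultimately have y: "exp (- 1) \<le> 1 - exp (- (a * ?s n / (2 * real (k n))))" by linarith
      have "exp (- (ln (real n) / 2)) \<le> exp (- real (k n))" using elim by simp
      also have "\<dots> = exp (- 1) ^ k n" by (simp add: exp_of_nat_mult[symmetric])
      also have "\<dots> \<le> (1 - exp (- (a * ?s n / (2 * real (k n))))) ^ k n" using y by (intro power_mono) auto
      finally show ?case .
    qed
    show "\<forall>\<^sub>F n in sequentially. c / 2 * ?s n \<le> real (k n)" using k by eventually_elim simp
  qed (use c in auto)
qed

end

section \<open>Assembly of the three regimes\<close>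

theorem theorem1p3:
  fixes N :: "'a::euclidean_space \<Rightarrow> real"
    and \<nu> :: "'a measure"
    and f :: "'a \<Rightarrow> real"
    and r :: "nat \<Rightarrow> real"
  assumes "is_norm N"
    and "has_bounded_density \<nu> f"
    and "\<And>n. 0 < r n"
    and "r \<longlonglongrightarrow> 0"
  shows
    "(\<forall>(\<beta>::nat) (\<alpha>::real).
       besicovitch_constant N \<beta> \<longrightarrow> 0 < \<alpha> \<longrightarrow> \<alpha> \<le> 1 / (real \<beta>)\<^sup>2 \<longrightarrow>
       (\<forall>\<^sub>F n in sequentially. real n * r n ^ DIM('a) \<le> real n powr (- \<alpha>)) \<longrightarrow>
       (\<exists>C1>0. \<exists>C2>0. C2 < 1 \<and>
         (\<forall>(M :: 'w measure) X q del ins.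
            (\<forall>n. 0 \<le> q n \<and> q n \<le> 1) \<longrightarrow>
            noisy_rgg_model M \<nu> X (\<lambda>_. 0) q del ins \<longrightarrow>
            ((\<forall>\<^sub>F n in sequentially. q n \<le> (1 / real n) powr C1) \<longrightarrow>
               as_sim M (noisy_clique_number N r X del ins) (\<lambda>n. 1)) \<and>
            ((\<forall>\<^sub>F n in sequentially. (1 / real n) powr C1 < q n \<and> q n \<le> C2) \<longrightarrow>
               as_sim M (noisy_clique_number N r X del ins) (\<lambda>n. log (1 / q n) (real n)))))) \<and>
    ((\<forall>\<epsilon>>0. (\<lambda>n. real n powr (- \<epsilon>)) \<lless> (\<lambda>n. real n * r n ^ DIM('a))) \<longrightarrow>
     (\<lambda>n. real n * r n ^ DIM('a)) \<lless> (\<lambda>n. ln (real n)) \<longrightarrow>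
       (\<exists>C1>0. \<exists>C2>0. C2 < 1 \<and>
         (\<forall>(M :: 'w measure) X q del ins.
            (\<forall>n. 0 \<le> q n \<and> q n \<le> 1) \<longrightarrow>
            noisy_rgg_model M \<nu> X (\<lambda>_. 0) q del ins \<longrightarrow>
            ((\<forall>\<^sub>F n in sequentially. q n \<le> (real n * r n ^ DIM('a) / ln (real n)) powr C1) \<longrightarrow>
               as_sim M (noisy_clique_number N r X del ins)
                 (\<lambda>n. ln (real n) / ln (ln (real n) / (real n * r n ^ DIM('a))))) \<and>
            ((\<forall>\<^sub>F n in sequentially.
                (real n * r n ^ DIM('a) / ln (real n)) powr C1 < q n \<and> q n \<le> C2) \<longrightarrow>
               as_sim M (noisy_clique_number N r X del ins) (\<lambda>n. log (1 / q n) (real n)))))) \<and>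
    (\<forall>t>0. (\<lambda>n. max_density f * real n * r n ^ DIM('a) / ln (real n)) \<longlonglongrightarrow> t \<longrightarrow>
       (\<exists>C1>0.
         (\<forall>(M :: 'w measure) X q del ins.
            (\<forall>n. 0 \<le> q n \<and> q n \<le> 1) \<longrightarrow>
            noisy_rgg_model M \<nu> X (\<lambda>_. 0) q del ins \<longrightarrow>
            (\<forall>\<^sub>F n in sequentially. q n \<le> C1) \<longrightarrow>
            as_sim M (noisy_clique_number N r X del ins) (\<lambda>n. real n * r n ^ DIM('a)))))"
proof (intro conjI)
  let ?s = "\<lambda>n. real n * r n ^ DIM('a)"
  have model: "noisy_rgg M N \<nu> f X q del ins" if "\<forall>n. 0 \<le> q n \<and> q n \<le> 1"
    "noisy_rgg_model M \<nu> X (\<lambda>_. 0) q del ins" for M :: "'w measure" and X q del ins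
    using that assms by unfold_locales auto
  show "\<forall>(\<beta>::nat) (\<alpha>::real).
       besicovitch_constant N \<beta> \<longrightarrow> 0 < \<alpha> \<longrightarrow> \<alpha> \<le> 1 / (real \<beta>)\<^sup>2 \<longrightarrow>
       (\<forall>\<^sub>F n in sequentially. real n * r n ^ DIM('a) \<le> real n powr (- \<alpha>)) \<longrightarrow>
       (\<exists>C1>0. \<exists>C2>0. C2 < 1 \<and>
         (\<forall>(M :: 'w measure) X q del ins.
            (\<forall>n. 0 \<le> q n \<and> q n \<le> 1) \<longrightarrow>
            noisy_rgg_model M \<nu> X (\<lambda>_. 0) q del ins \<longrightarrow>
            ((\<forall>\<^sub>F n in sequentially. q n \<le> (1 / real n) powr C1) \<longrightarrow>
               as_sim M (noisy_clique_number N r X del ins) (\<lambda>n. 1)) \<and>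
            ((\<forall>\<^sub>F n in sequentially. (1 / real n) powr C1 < q n \<and> q n \<le> C2) \<longrightarrow>
               as_sim M (noisy_clique_number N r X del ins) (\<lambda>n. log (1 / q n) (real n)))))"
  proof (intro allI impI, rule exI[of _ 1], rule conjI, simp, rule exI[of _ "1 / 16"], intro conjI allI impI)
    fix \<alpha> :: real
    assume \<alpha>: "0 < \<alpha>" and le: "\<forall>\<^sub>F n in sequentially. ?s n \<le> real n powr (- \<alpha>)"
    fix M :: "'w measure" and X q del ins
    assume "\<forall>n. 0 \<le> q n \<and> q n \<le> 1" "noisy_rgg_model M \<nu> X (\<lambda>_. 0) q del ins"
    then interpret noisy_rgg M N \<nu> f r X q del ins by (rule model)
    have powr: "(1 / real n) powr 1 = 1 / real n" for n by simp
    show "as_sim M \<xi> (\<lambda>n. 1)" if "\<forall>\<^sub>F n in sequentially. q n \<le> (1 / real n) powr 1"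
      using that unfolding powr by (rule as_sim_polynomial(1)[OF assms(3) \<alpha> le])
    show "as_sim M \<xi> (\<lambda>n. log (1 / q n) (real n))"
      if "\<forall>\<^sub>F n in sequentially. (1 / real n) powr 1 < q n \<and> q n \<le> 1 / 16"
      using that unfolding powr by (rule as_sim_polynomial(2)[OF assms(3) \<alpha> le])
  qed simp_all
  show "(\<forall>\<epsilon>>0. (\<lambda>n. real n powr (- \<epsilon>)) \<lless> ?s) \<longrightarrow> ?s \<lless> (\<lambda>n. ln (real n)) \<longrightarrow>
       (\<exists>C1>0. \<exists>C2>0. C2 < 1 \<and>
         (\<forall>(M :: 'w measure) X q del ins.
            (\<forall>n. 0 \<le> q n \<and> q n \<le> 1) \<longrightarrow>
            noisy_rgg_model M \<nu> X (\<lambda>_. 0) q del ins \<longrightarrow>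
            ((\<forall>\<^sub>F n in sequentially. q n \<le> (?s n / ln (real n)) powr C1) \<longrightarrow>
               as_sim M (noisy_clique_number N r X del ins)
                 (\<lambda>n. ln (real n) / ln (ln (real n) / ?s n))) \<and>
            ((\<forall>\<^sub>F n in sequentially. (?s n / ln (real n)) powr C1 < q n \<and> q n \<le> C2) \<longrightarrow>
               as_sim M (noisy_clique_number N r X del ins) (\<lambda>n. log (1 / q n) (real n)))))"
  proof (intro impI, rule exI[of _ 1], rule conjI, simp, rule exI[of _ "1 / 16"], intro conjI allI impI)
    assume ge: "\<forall>\<epsilon>>0. (\<lambda>n. real n powr (- \<epsilon>)) \<lless> ?s" and le: "?s \<lless> (\<lambda>n. ln (real n))"
    fix M :: "'w measure" and X q del ins
    assume "\<forall>n. 0 \<le> q n \<and> q n \<le> 1" "noisy_rgg_model M \<nu> X (\<lambda>_. 0) q del ins"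
    then interpret noisy_rgg M N \<nu> f r X q del ins by (rule model)
    have lim: "(\<lambda>n. real n powr (- (1 / 8)) / ?s n) \<longlonglongrightarrow> 0" "(\<lambda>n. ?s n / ln (real n)) \<longlonglongrightarrow> 0"
      using ge[rule_format, of "1 / 8"] le by (simp_all add: much_less_def)
    \<comment> \<open>For \<open>n = 0\<close> and \<open>n = 1\<close> both sides are 0 because
      division by 0 gives 0.\<close>
    have powr: "(?s n / ln (real n)) powr 1 = 1 / (ln (real n) / ?s n)" for n
      using assms(3)[of n] by (cases "n = 0") simp_all
    note main = as_sim_subpolynomial[OF assms(3,4) lim refl]
    show "as_sim M \<xi> (\<lambda>n. ln (real n) / ln (ln (real n) / ?s n))"
      if "\<forall>\<^sub>F n in sequentially. q n \<le> (?s n / ln (real n)) powr 1"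
      using that unfolding powr by (rule main(1))
    show "as_sim M \<xi> (\<lambda>n. log (1 / q n) (real n))"
      if "\<forall>\<^sub>F n in sequentially. (?s n / ln (real n)) powr 1 < q n \<and> q n \<le> 1 / 16"
      using that unfolding powr by (rule main(2))
  qed simp_all
  show "\<forall>t>0. (\<lambda>n. max_density f * real n * r n ^ DIM('a) / ln (real n)) \<longlonglongrightarrow> t \<longrightarrow>
       (\<exists>C1>0.
         (\<forall>(M :: 'w measure) X q del ins.
            (\<forall>n. 0 \<le> q n \<and> q n \<le> 1) \<longrightarrow>
            noisy_rgg_model M \<nu> X (\<lambda>_. 0) q del ins \<longrightarrow>
            (\<forall>\<^sub>F n in sequentially. q n \<le> C1) \<longrightarrow>
            as_sim M (noisy_clique_number N r X del ins) ?s))"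
  proof (intro impI exI[of _ "1/16::real"] conjI allI)
    fix t :: real
    assume t: "0 < t" and lim: "(\<lambda>n. max_density f * real n * r n ^ DIM('a) / ln (real n)) \<longlonglongrightarrow> t"
    \<comment> \<open>The positive limit forces \<open>max_density f > 0\<close>, so dividing by it
      gives \<open>n * r ^ d / ln n\<close> a positive limit.\<close>
    have "\<forall>\<^sub>F n in sequentially. 0 < max_density f * real n * r n ^ DIM('a) / ln (real n)"
      using lim t by (rule order_tendstoD)
    then obtain n where "0 < max_density f * real n * r n ^ DIM('a) / ln (real n)"
      using eventually_happens'[OF sequentially_bot] by blast
    then have \<sigma>: "0 < max_density f"
      using assms(3)[of n] by (cases "n = 0") (auto simp: zero_less_mult_iff zero_less_divide_iff not_less)
    have lim': "(\<lambda>n. ?s n / ln (real n)) \<longlonglongrightarrow> t / max_density f"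
      using tendsto_divide[OF lim tendsto_const[of "max_density f"]] \<sigma> by (simp add: field_simps)
    fix M :: "'w measure" and X q del ins
    assume "\<forall>n. 0 \<le> q n \<and> q n \<le> 1" "noisy_rgg_model M \<nu> X (\<lambda>_. 0) q del ins"
    then interpret noisy_rgg M N \<nu> f r X q del ins by (rule model)
    assume "\<forall>\<^sub>F n in sequentially. q n \<le> 1 / 16"
    then show "as_sim M \<xi> ?s"
      using as_sim_logarithmic[OF assms(3,4) lim'] t \<sigma> by simp
  qed simp
qed

end
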